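(* Let $I$ be an index set and, for each $i\in I$, let $(\mathcal{A}_i,\mathcal{A}_i^+,\mathcal{A}_i^-,\theta_i)$ be reflection data and $\tau_i:\mathcal{A}_i\to\mathbb{C}$ a linear functional with $\tau_i(1)=1$. Assume that, for each $i\in I$, $\tau_i$ is reflection positive with respect to $(\mathcal{A}_i,\mathcal{A}_i^+,\mathcal{A}_i^-,\theta_i)$. Let $$(\mathcal{A},\mathcal{A}^+,\mathcal{A}^-,\theta,\tau)=\ast_{i\in I}(\mathcal{A}_i,\mathcal{A}_i^+,\mathcal{A}_i^-,\theta_i,\tau_i)$$ be their bi-free product. Then $\tau$ is reflection positive with respect to $(\mathcal{A},\mathcal{A}^+,\mathcal{A}^-,\theta)$, i.e. $\tau(\theta(a)a)\geq 0$ for all $a\in\mathcal{A}^+$.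
   Context: All algebras are unital associative algebras over $\mathbb{C}$, and subalgebras contain the unit. Everything is purely algebraic (no topology). **Reflection data.** A tuple $(\mathcal{A},\mathcal{A}^+,\mathcal{A}^-,\theta)$ is called reflection data if $\mathcal{A}$ is an algebra, $\mathcal{A}^+,\mathcal{A}^-$ are subalgebras of $\mathcal{A}$ with $\mathcal{A}=\mathrm{span}\{a_-a_+\mid a_-\in\mathcal{A}^-,\ a_+\in\mathcal{A}^+\}$ and $a_-a_+=a_+a_-$ for all $a_-\in\mathcal{A}^-$, $a_+\in\mathcal{A}^+$, and $\theta:\mathcal{A}\to\mathcal{A}$ is an anti-linear homomorphism (so multiplicative, $\theta(ab)=\theta(a)\theta(b)$) with $\theta\circ\theta=\mathrm{id}$ and $\theta(\mathcal{A}^+)=\mathcal{A}^-$. **Reflection positivity.** A linear functional $\tau:\mathcal{A}\to\mathbb{C}$ is reflection positive with respect to $(\mathcal{A},\mathcal{A}^+,\mathcal{A}^-,\theta)$ if $\tau(\theta(a)a)\ge 0$ (i.e. is real and nonnegative) for all $a\in\mathcal{A}^+$. **Bi-free product.** Given, for each $i\in I$, reflection data $(\mathcal{A}_i,\mathcal{A}_i^+,\mathcal{A}_i^-,\theta_i)$ and a linear functional $\tau_i:\mathcal{A}_i\to\mathbb{C}$ with $\tau_i(1)=1$, the bi-free product $(\mathcal{A},\mathcal{A}^+,\mathcal{A}^-,\theta,\tau)=\ast_{i\in I}(\mathcal{A}_i,\mathcal{A}_i^+,\mathcal{A}_i^-,\theta_i,\tau_i)$ is defined as follows. - $\mathcal{A}^+$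 is the free product (of unital algebras, with units identified) of the $\mathcal{A}_i^+$, $i\in I$; $\mathcal{A}^-$ is the free product of the $\mathcal{A}_i^-$, $i\in I$. - $\mathcal{A}=\mathcal{A}^-\otimes\mathcal{A}^+$ is the algebraic tensor product algebra, with $\mathcal{A}^-$ and $\mathcal{A}^+$ regarded as commuting subalgebras of $\mathcal{A}$ in the canonical way. - $\theta:\mathcal{A}\to\mathcal{A}$ is the anti-linear homomorphism which on $\mathcal{A}^+$ (with values in $\mathcal{A}^-$) and on $\mathcal{A}^-$ (with values in $\mathcal{A}^+$) is the free product of the corresponding restrictions of the $\theta_i$; i.e. $\theta(a)=\theta_i(a)$ for $a\in\mathcal{A}_i^{\pm}$. - $\tau:\mathcal{A}\to\mathbb{C}$ is the linear functional determined by the values $\tau(\theta(a)b)$ for $a,b\in\mathcal{A}^+$ as follows. Every element of $\mathcal{A}^+$ is a linear combination of terms $b_n\cdots b_1$ with $n\ge 0$, $b_k\in\mathcal{A}_{i(k)}^+$, $i(k)\neq i(k+1)$ for $k=1,\dots,n-1$, and $\tau_{i(k)}(b_k)=0$ for all $k$ (for $n=0$ the term is a multiple of $1$; the empty product is $1$). For two such terms $b_n\cdots b_1$ with $b_k\in\mathcal{A}_{i(k)}^+$ and $a_m\cdots a_1$ with $a_k\in\mathcal{A}_{j(k)}^+$ (thus $j(k)\ne j(k+1)$ and $\tau_{j(k)}(a_k)=0$), one puts $$\tau\bigl(\theta(a_m)\cdots\theta(a_1)\,b_n\cdots b_1\bigr)=\delta_{mn}\prod_{1\le k\le n}\delta_{i(k)j(k)}\,\tau_{i(k)}\bigl(\theta_{i(k)}(a_k)b_k\bigr),$$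 where the right-hand side is understood to be $0$ unless $m=n$ and $i(k)=j(k)$ for all $k$, and equals $1$ for $m=n=0$. *)

theory Defs
  imports Complex_Main "HOL-Algebra.QuotRing" "HOL-Algebra.Module" "HOL-Algebra.Subrings"
    "HOL-Library.Nonpos_Ints" "HOL.Hull"
begin

section \<open>Unital associative complex algebras\<close>

text \<open>
  The locale \<open>algebra\<close> of HOL-Algebra is commutative, so the noncommutative notion is set up here
  on the same records.  The multiplication part of a module record is the product of the algebra.
\<close>

definition complex_ring :: "complex ring" where
  "complex_ring = \<lparr>carrier = UNIV, mult = (*), one = 1, zero = 0, add = (+)\<rparr>"

type_synonym 'a calg = "(complex, 'a) module"

locale complex_algebra = module complex_ring A + ring A for A (structure) +
  assumes smult_mult_left:
      "\<lbrakk>x \<in> carrier A; y \<in> carrier A\<rbrakk> \<Longrightarrow> (c \<odot> x) \<otimes> y = c \<odot> (x \<otimes> y)"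
    and smult_mult_right:
      "\<lbrakk>x \<in> carrier A; y \<in> carrier A\<rbrakk> \<Longrightarrow> x \<otimes> (c \<odot> y) = c \<odot> (x \<otimes> y)"

text \<open>Subalgebras contain the unit, since \<^locale>\<open>subring\<close> is unital.\<close>

definition complex_subalgebra :: "'a set \<Rightarrow> 'a calg \<Rightarrow> bool" where
  "complex_subalgebra S A \<longleftrightarrow> subring S A \<and> submodule S complex_ring A"

definition complex_span :: "'a calg \<Rightarrow> 'a set \<Rightarrow> 'a set" where
  "complex_span A S = (\<lambda>H. submodule H complex_ring A) hull S"

definition linear_functional :: "'a calg \<Rightarrow> ('a \<Rightarrow> complex) \<Rightarrow> bool" where
  "linear_functional A \<tau> \<longleftrightarrow>
     (\<forall>x\<in>carrier A. \<forall>y\<in>carrier A. \<tau> (x \<oplus>\<^bsub>A\<^esub> y) = \<tau> x + \<tau> y) \<and>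
     (\<forall>c. \<forall>x\<in>carrier A. \<tau> (c \<odot>\<^bsub>A\<^esub> x) = c * \<tau> x)"

definition antilinear_hom :: "'a calg \<Rightarrow> 'b calg \<Rightarrow> ('a \<Rightarrow> 'b) \<Rightarrow> bool" where
  "antilinear_hom A B \<theta> \<longleftrightarrow>
     \<theta> \<in> ring_hom A B \<and> (\<forall>c. \<forall>x\<in>carrier A. \<theta> (c \<odot>\<^bsub>A\<^esub> x) = cnj c \<odot>\<^bsub>B\<^esub> \<theta> x)"


section \<open>Reflection data and reflection positivity\<close>

definition reflection_data :: "'a calg \<Rightarrow> 'a set \<Rightarrow> 'a set \<Rightarrow> ('a \<Rightarrow> 'a) \<Rightarrow> bool" where
  "reflection_data A Ap Am \<theta> \<longleftrightarrow>
     complex_algebra A \<and> complex_subalgebra Ap A \<and> complex_subalgebra Am A \<and>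
     carrier A = complex_span A {x \<otimes>\<^bsub>A\<^esub> y | x y. x \<in> Am \<and> y \<in> Ap} \<and>
     (\<forall>x\<in>Am. \<forall>y\<in>Ap. x \<otimes>\<^bsub>A\<^esub> y = y \<otimes>\<^bsub>A\<^esub> x) \<and>
     antilinear_hom A A \<theta> \<and> (\<forall>x\<in>carrier A. \<theta> (\<theta> x) = x) \<and> \<theta> ` Ap = Am"

text \<open>The condition depends on \<open>Am\<close> only through \<open>\<theta>\<close>.\<close>

definition reflection_positive ::
    "'a calg \<Rightarrow> 'a set \<Rightarrow> 'a set \<Rightarrow> ('a \<Rightarrow> 'a) \<Rightarrow> ('a \<Rightarrow> complex) \<Rightarrow> bool" where
  "reflection_positive A Ap Am \<theta> \<tau> \<longleftrightarrow> (\<forall>a\<in>Ap. \<tau> (\<theta> a \<otimes>\<^bsub>A\<^esub> a) \<in> \<real>\<^sub>\<ge>\<^sub>0)"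


section \<open>Monoid algebras and quotients\<close>

definition monoid_algebra :: "('m, 'x) monoid_scheme \<Rightarrow> ('m \<Rightarrow> complex) calg" where
  "monoid_algebra M =
     \<lparr>carrier = {f. finite {m. f m \<noteq> 0} \<and> {m. f m \<noteq> 0} \<subseteq> carrier M},
      mult = (\<lambda>f g m. \<Sum>(x, y) \<in> {(x, y). f x \<noteq> 0 \<and> g y \<noteq> 0 \<and> x \<otimes>\<^bsub>M\<^esub> y = m}. f x * g y),
      one = (\<lambda>m. if m = \<one>\<^bsub>M\<^esub> then 1 else 0),
      zero = (\<lambda>m. 0),
      add = (\<lambda>f g m. f m + g m),
      smult = (\<lambda>c f m. c * f m)\<rparr>"

definition basis_elem :: "'m \<Rightarrow> 'm \<Rightarrow> complex" where
  "basis_elem x = (\<lambda>m. if m = x then 1 else 0)"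

text \<open>The ring quotient, with scalar multiplication defined on cosets like \<^const>\<open>rcoset_mult\<close>.\<close>

definition quotient_algebra :: "'a calg \<Rightarrow> 'a set \<Rightarrow> 'a set calg" where
  "quotient_algebra A J =
     \<lparr>carrier = carrier (A Quot J), mult = mult (A Quot J), one = one (A Quot J),
      zero = zero (A Quot J), add = add (A Quot J),
      smult = (\<lambda>c X. \<Union>x\<in>X. J +>\<^bsub>A\<^esub> (c \<odot>\<^bsub>A\<^esub> x))\<rparr>"


section \<open>Free products of unital algebras\<close>

text \<open>
  The free product is the free algebra on the disjoint union of the carriers, modulo the ideal that
  makes each inclusion a unital algebra homomorphism.  The relation for the units sends every
  unit of a factor to the empty word.
\<close>

definition word_monoid :: "'i set \<Rightarrow> ('i \<Rightarrow> 'a calg) \<Rightarrow> ('i \<times> 'a) list monoid" where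
  "word_monoid I A =
     \<lparr>carrier = lists (SIGMA i:I. carrier (A i)), mult = (@), one = []\<rparr>"

definition free_relations :: "'i set \<Rightarrow> ('i \<Rightarrow> 'a calg) \<Rightarrow> (('i \<times> 'a) list \<Rightarrow> complex) set" where
  "free_relations I A =
     {(\<lambda>w. basis_elem [(i, x \<oplus>\<^bsub>A i\<^esub> y)] w - basis_elem [(i, x)] w - basis_elem [(i, y)] w)
        | i x y. i \<in> I \<and> x \<in> carrier (A i) \<and> y \<in> carrier (A i)} \<union>
     {(\<lambda>w. basis_elem [(i, c \<odot>\<^bsub>A i\<^esub> x)] w - c * basis_elem [(i, x)] w)
        | i c x. i \<in> I \<and> x \<in> carrier (A i)} \<union>
     {(\<lambda>w. basis_elem [(i, x \<otimes>\<^bsub>A i\<^esub> y)] w - basis_elem [(i, x), (i, y)] w)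
        | i x y. i \<in> I \<and> x \<in> carrier (A i) \<and> y \<in> carrier (A i)} \<union>
     {(\<lambda>w. basis_elem [(i, \<one>\<^bsub>A i\<^esub>)] w - basis_elem [] w) | i. i \<in> I}"

definition free_ideal :: "'i set \<Rightarrow> ('i \<Rightarrow> 'a calg) \<Rightarrow> (('i \<times> 'a) list \<Rightarrow> complex) set" where
  "free_ideal I A = Idl\<^bsub>monoid_algebra (word_monoid I A)\<^esub> (free_relations I A)"

definition free_product :: "'i set \<Rightarrow> ('i \<Rightarrow> 'a calg) \<Rightarrow> (('i \<times> 'a) list \<Rightarrow> complex) set calg" where
  "free_product I A = quotient_algebra (monoid_algebra (word_monoid I A)) (free_ideal I A)"

definition free_incl ::
    "'i set \<Rightarrow> ('i \<Rightarrow> 'a calg) \<Rightarrow> 'i \<Rightarrow> 'a \<Rightarrow> (('i \<times> 'a) list \<Rightarrow> complex) set" where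
  "free_incl I A i x = free_ideal I A +>\<^bsub>monoid_algebra (word_monoid I A)\<^esub> basis_elem [(i, x)]"


section \<open>Tensor products of algebras\<close>

text \<open>
  The free vector space on pairs, modulo the bilinearity relations.  As the monoid algebra of the
  direct product of the two multiplicative monoids, this free space carries the product
  (b, c) (b', c') = (b b', c c').  For it the linear span of the bilinearity relations
  is already a two-sided ideal, so the ideal taken below is just their span.
\<close>

definition tensor_relations :: "'a calg \<Rightarrow> 'b calg \<Rightarrow> ('a \<times> 'b \<Rightarrow> complex) set" where
  "tensor_relations B C =
     {(\<lambda>p. basis_elem (b \<oplus>\<^bsub>B\<^esub> b', c) p - basis_elem (b, c) p - basis_elem (b', c) p)
        | b b' c. b \<in> carrier B \<and> b' \<in> carrier B \<and> c \<in> carrier C} \<union>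
     {(\<lambda>p. basis_elem (b, c \<oplus>\<^bsub>C\<^esub> c') p - basis_elem (b, c) p - basis_elem (b, c') p)
        | b c c'. b \<in> carrier B \<and> c \<in> carrier C \<and> c' \<in> carrier C} \<union>
     {(\<lambda>p. basis_elem (z \<odot>\<^bsub>B\<^esub> b, c) p - z * basis_elem (b, c) p)
        | z b c. b \<in> carrier B \<and> c \<in> carrier C} \<union>
     {(\<lambda>p. basis_elem (b, z \<odot>\<^bsub>C\<^esub> c) p - z * basis_elem (b, c) p)
        | z b c. b \<in> carrier B \<and> c \<in> carrier C}"

definition tensor_ideal :: "'a calg \<Rightarrow> 'b calg \<Rightarrow> ('a \<times> 'b \<Rightarrow> complex) set" where
  "tensor_ideal B C = Idl\<^bsub>monoid_algebra (B \<times>\<times> C)\<^esub> (tensor_relations B C)"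

definition tensor_algebra :: "'a calg \<Rightarrow> 'b calg \<Rightarrow> ('a \<times> 'b \<Rightarrow> complex) set calg" where
  "tensor_algebra B C = quotient_algebra (monoid_algebra (B \<times>\<times> C)) (tensor_ideal B C)"

definition pure_tensor :: "'a calg \<Rightarrow> 'b calg \<Rightarrow> 'a \<Rightarrow> 'b \<Rightarrow> ('a \<times> 'b \<Rightarrow> complex) set" where
  "pure_tensor B C b c = tensor_ideal B C +>\<^bsub>monoid_algebra (B \<times>\<times> C)\<^esub> basis_elem (b, c)"


section \<open>The bi-free product\<close>

type_synonym ('i, 'a) free_elem = "(('i \<times> 'a) list \<Rightarrow> complex) set"
type_synonym ('i, 'a) bifree_elem = "(('i, 'a) free_elem \<times> ('i, 'a) free_elem \<Rightarrow> complex) set"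

text \<open>For a family of subalgebras \<open>S i\<close> of \<open>A i\<close>, the family of these as algebras.\<close>

abbreviation restr :: "('i \<Rightarrow> 'a calg) \<Rightarrow> ('i \<Rightarrow> 'a set) \<Rightarrow> 'i \<Rightarrow> 'a calg" where
  "restr A S \<equiv> \<lambda>i. (A i)\<lparr>carrier := S i\<rparr>"

definition bifree_algebra ::
    "'i set \<Rightarrow> ('i \<Rightarrow> 'a calg) \<Rightarrow> ('i \<Rightarrow> 'a set) \<Rightarrow> ('i \<Rightarrow> 'a set) \<Rightarrow> ('i, 'a) bifree_elem calg" where
  "bifree_algebra I A Ap Am =
     tensor_algebra (free_product I (restr A Am)) (free_product I (restr A Ap))"

text \<open>The canonical copies of the two free products inside the tensor product.\<close>

definition bifree_embed_plus ::
    "'i set \<Rightarrow> ('i \<Rightarrow> 'a calg) \<Rightarrow> ('i \<Rightarrow> 'a set) \<Rightarrow> ('i \<Rightarrow> 'a set) \<Rightarrow>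
     ('i, 'a) free_elem \<Rightarrow> ('i, 'a) bifree_elem" where
  "bifree_embed_plus I A Ap Am x =
     pure_tensor (free_product I (restr A Am)) (free_product I (restr A Ap))
       \<one>\<^bsub>free_product I (restr A Am)\<^esub> x"

definition bifree_embed_minus ::
    "'i set \<Rightarrow> ('i \<Rightarrow> 'a calg) \<Rightarrow> ('i \<Rightarrow> 'a set) \<Rightarrow> ('i \<Rightarrow> 'a set) \<Rightarrow>
     ('i, 'a) free_elem \<Rightarrow> ('i, 'a) bifree_elem" where
  "bifree_embed_minus I A Ap Am x =
     pure_tensor (free_product I (restr A Am)) (free_product I (restr A Ap))
       x \<one>\<^bsub>free_product I (restr A Ap)\<^esub>"

definition bifree_plus ::
    "'i set \<Rightarrow> ('i \<Rightarrow> 'a calg) \<Rightarrow> ('i \<Rightarrow> 'a set) \<Rightarrow> ('i \<Rightarrow> 'a set) \<Rightarrow> ('i, 'a) bifree_elem set" where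
  "bifree_plus I A Ap Am =
     bifree_embed_plus I A Ap Am ` carrier (free_product I (restr A Ap))"

definition bifree_minus ::
    "'i set \<Rightarrow> ('i \<Rightarrow> 'a calg) \<Rightarrow> ('i \<Rightarrow> 'a set) \<Rightarrow> ('i \<Rightarrow> 'a set) \<Rightarrow> ('i, 'a) bifree_elem set" where
  "bifree_minus I A Ap Am =
     bifree_embed_minus I A Ap Am ` carrier (free_product I (restr A Am))"

definition factor_plus ::
    "'i set \<Rightarrow> ('i \<Rightarrow> 'a calg) \<Rightarrow> ('i \<Rightarrow> 'a set) \<Rightarrow> ('i \<Rightarrow> 'a set) \<Rightarrow>
     'i \<Rightarrow> 'a \<Rightarrow> ('i, 'a) bifree_elem" where
  "factor_plus I A Ap Am i x = bifree_embed_plus I A Ap Am (free_incl I (restr A Ap) i x)"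

definition factor_minus ::
    "'i set \<Rightarrow> ('i \<Rightarrow> 'a calg) \<Rightarrow> ('i \<Rightarrow> 'a set) \<Rightarrow> ('i \<Rightarrow> 'a set) \<Rightarrow>
     'i \<Rightarrow> 'a \<Rightarrow> ('i, 'a) bifree_elem" where
  "factor_minus I A Ap Am i x = bifree_embed_minus I A Ap Am (free_incl I (restr A Am) i x)"

definition bifree_reflection ::
    "'i set \<Rightarrow> ('i \<Rightarrow> 'a calg) \<Rightarrow> ('i \<Rightarrow> 'a set) \<Rightarrow> ('i \<Rightarrow> 'a set) \<Rightarrow> ('i \<Rightarrow> 'a \<Rightarrow> 'a) \<Rightarrow>
     (('i, 'a) bifree_elem \<Rightarrow> ('i, 'a) bifree_elem) \<Rightarrow> bool" where
  "bifree_reflection I A Ap Am \<theta> \<Theta> \<longleftrightarrow>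
     antilinear_hom (bifree_algebra I A Ap Am) (bifree_algebra I A Ap Am) \<Theta> \<and>
     (\<forall>i\<in>I. \<forall>a\<in>Ap i. \<Theta> (factor_plus I A Ap Am i a) = factor_minus I A Ap Am i (\<theta> i a)) \<and>
     (\<forall>i\<in>I. \<forall>a\<in>Am i. \<Theta> (factor_minus I A Ap Am i a) = factor_plus I A Ap Am i (\<theta> i a))"

text \<open>
  The list \<open>[(i(n), b\<^sub>n), \<dots>, (i(1), b\<^sub>1)]\<close> encodes the term \<open>b\<^sub>n \<cdots> b\<^sub>1\<close>, in the order of its factors.
\<close>

definition centred_word ::
    "'i set \<Rightarrow> ('i \<Rightarrow> 'a set) \<Rightarrow> ('i \<Rightarrow> 'a \<Rightarrow> complex) \<Rightarrow> ('i \<times> 'a) list \<Rightarrow> bool" where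
  "centred_word I Ap \<tau> w \<longleftrightarrow>
     (\<forall>(i, b) \<in> set w. i \<in> I \<and> b \<in> Ap i \<and> \<tau> i b = 0) \<and>
     successively (\<lambda>p q. fst p \<noteq> fst q) w"

definition list_product :: "('a, 'x) monoid_scheme \<Rightarrow> 'a list \<Rightarrow> 'a" where
  "list_product G xs = foldr (\<lambda>x y. x \<otimes>\<^bsub>G\<^esub> y) xs \<one>\<^bsub>G\<^esub>"

text \<open>
  In the value below, equality of the index lists covers both the equality of the lengths and all
  the Kronecker deltas of the indices.
\<close>

definition bifree_functional ::
    "'i set \<Rightarrow> ('i \<Rightarrow> 'a calg) \<Rightarrow> ('i \<Rightarrow> 'a set) \<Rightarrow> ('i \<Rightarrow> 'a set) \<Rightarrow> ('i \<Rightarrow> 'a \<Rightarrow> 'a) \<Rightarrow>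
     ('i \<Rightarrow> 'a \<Rightarrow> complex) \<Rightarrow> (('i, 'a) bifree_elem \<Rightarrow> ('i, 'a) bifree_elem) \<Rightarrow>
     (('i, 'a) bifree_elem \<Rightarrow> complex) \<Rightarrow> bool" where
  "bifree_functional I A Ap Am \<theta> \<tau> \<Theta> T \<longleftrightarrow>
     linear_functional (bifree_algebra I A Ap Am) T \<and>
     (\<forall>v w. centred_word I Ap \<tau> v \<longrightarrow> centred_word I Ap \<tau> w \<longrightarrow>
        T (list_product (bifree_algebra I A Ap Am)
             (map (\<lambda>(j, a). \<Theta> (factor_plus I A Ap Am j a)) v @
              map (\<lambda>(i, b). factor_plus I A Ap Am i b) w)) =
        (if map fst v = map fst w
         then \<Prod>((j, a), (i, b)) \<leftarrow> zip v w. \<tau> i (\<theta> i a \<otimes>\<^bsub>A i\<^esub> b)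
         else 0))"

text \<open>
  The reflection and the functional of a bi-free product are determined on the carrier by
  their defining properties; their values elsewhere are irrelevant.
\<close>

definition is_bifree_product ::
    "'i set \<Rightarrow> ('i \<Rightarrow> 'a calg) \<Rightarrow> ('i \<Rightarrow> 'a set) \<Rightarrow> ('i \<Rightarrow> 'a set) \<Rightarrow> ('i \<Rightarrow> 'a \<Rightarrow> 'a) \<Rightarrow>
     ('i \<Rightarrow> 'a \<Rightarrow> complex) \<Rightarrow> ('i, 'a) bifree_elem calg \<Rightarrow> ('i, 'a) bifree_elem set \<Rightarrow>
     ('i, 'a) bifree_elem set \<Rightarrow> (('i, 'a) bifree_elem \<Rightarrow> ('i, 'a) bifree_elem) \<Rightarrow>
     (('i, 'a) bifree_elem \<Rightarrow> complex) \<Rightarrow> bool" where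
  "is_bifree_product I A Ap Am \<theta> \<tau> B Bp Bm \<Theta> T \<longleftrightarrow>
     B = bifree_algebra I A Ap Am \<and> Bp = bifree_plus I A Ap Am \<and> Bm = bifree_minus I A Ap Am \<and>
     bifree_reflection I A Ap Am \<theta> \<Theta> \<and> bifree_functional I A Ap Am \<theta> \<tau> \<Theta> T"

end

theory Submission
  imports Defs
begin

text \<open>
  Write \<open>F\<close> for the free product of the algebras \<open>Ap i\<close>, whose image is the positive part of the
  bi-free product, and consider on \<open>F\<close> the form \<open>s x y = T (\<Theta> x \<cdot> y)\<close>.  It is sesquilinear, because
  \<open>\<Theta>\<close> is antilinear and \<open>T\<close> is linear, and the claim is that \<open>s x x \<ge> 0\<close> for every \<open>x\<close>.

  Every element of \<open>F\<close> is a linear combination of centred words (\<open>centred_words_span\<close>).  Indeed, the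
  span of the centred words contains \<open>1\<close> and is stable under left multiplication by each factor: to
  multiply a word by \<open>a\<close> from the algebra with index \<open>i\<close>, first absorb the leading letter of the
  word into \<open>a\<close> if it has the same index, and then split the result into a scalar and a centred
  element.

  For centred words the values of \<open>s\<close> are those prescribed in the definition of the bi-free product.
  So, for \<open>x\<close> the sum of the \<open>c w \<cdot> w\<close> over a finite set \<open>V\<close> of centred words, \<open>s x x\<close> is the double
  sum of \<open>cnj (c v) * c w * word_kernel v w\<close> over \<open>V\<close>, and it remains to see that the matrix
  \<open>word_kernel\<close> is positive semidefinite on every finite family of words
  (\<open>word_kernel_positive\<close>).  For words of length one it is block diagonal with one block for each
  index, and a block is a Gram matrix of the form \<open>\<tau> i (\<theta> i a \<cdot> b)\<close>, which is positive by assumption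
  (\<open>letter_kernel_positive\<close>).  For nonempty words in general it is the entrywise product of the matrix of the
  first letters and the matrix of the remaining words, and entrywise products of positive
  semidefinite matrices are positive semidefinite by the Schur product theorem
  (\<open>positive_kernel_mult\<close>).

  Free products and tensor products are quotients of monoid algebras here.  The argument uses that
  these quotients are algebras, that the maps from the factors into them are homomorphisms, and that
  a free product is generated by its factors (\<open>free_product_generated\<close>).
\<close>

section \<open>Positive kernels\<close>

text \<open>
  The positive semidefinite matrices, as functions on an index set instead of on a set of vectors:
  kernels can then be pulled back along maps that are not injective, such as the tail of a word.
\<close>

definition positive_kernel :: "'k set \<Rightarrow> ('k \<Rightarrow> 'k \<Rightarrow> complex) \<Rightarrow> bool" where
  "positive_kernel J K \<longleftrightarrow> (\<forall>c. (\<Sum>x\<in>J. \<Sum>y\<in>J. cnj (c x) * c y * K x y) \<in> \<real>\<^sub>\<ge>\<^sub>0)"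

lemma positive_kernelD:
  "positive_kernel J K \<Longrightarrow> (\<Sum>x\<in>J. \<Sum>y\<in>J. cnj (c x) * c y * K x y) \<in> \<real>\<^sub>\<ge>\<^sub>0"
  by (simp add: positive_kernel_def)

lemma positive_kernel_cong:
  assumes "\<And>x y. x \<in> J \<Longrightarrow> y \<in> J \<Longrightarrow> K x y = L x y"
  shows "positive_kernel J K \<longleftrightarrow> positive_kernel J L"
  using assms by (simp add: positive_kernel_def)

lemma positive_kernel_add:
  assumes "positive_kernel J K" "positive_kernel J L"
  shows "positive_kernel J (\<lambda>x y. K x y + L x y)"
  using assms by (simp add: positive_kernel_def distrib_left sum.distrib)

lemma positive_kernel_sum:
  assumes "\<And>i. i \<in> S \<Longrightarrow> positive_kernel J (K i)"
  shows "positive_kernel J (\<lambda>x y. \<Sum>i\<in>S. K i x y)"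
  using assms
proof (induction S rule: infinite_finite_induct)
  case (insert i S)
  then show ?case
    using positive_kernel_add[of J "K i"] by simp
qed (simp_all add: positive_kernel_def)

lemma positive_kernel_scale:
  assumes "positive_kernel J K"
  shows "positive_kernel J (\<lambda>x y. cnj (g x) * g y * K x y)"
  unfolding positive_kernel_def
proof
  fix c
  show "(\<Sum>x\<in>J. \<Sum>y\<in>J. cnj (c x) * c y * (cnj (g x) * g y * K x y)) \<in> \<real>\<^sub>\<ge>\<^sub>0"
    using positive_kernelD[OF assms, of "\<lambda>x. c x * g x"] by (simp add: ac_simps)
qed

lemma positive_kernel_one: "positive_kernel J (\<lambda>x y. 1)"
proof -
  have "(\<Sum>x\<in>J. \<Sum>y\<in>J. cnj (c x) * c y) = cnj (sum c J) * sum c J" for c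
    by (simp add: sum_product)
  then show ?thesis
    by (simp add: positive_kernel_def complex_nonneg_Reals_iff sum_negf)
qed

lemma positive_kernel_extend_by_zero:
  assumes "finite J" and "positive_kernel {x \<in> J. P x} K"
  shows "positive_kernel J (\<lambda>x y. if P x \<and> P y then K x y else 0)"
  unfolding positive_kernel_def
proof
  fix c
  have "(\<Sum>x\<in>J. \<Sum>y\<in>J. cnj (c x) * c y * (if P x \<and> P y then K x y else 0))
      = (\<Sum>x\<in>{x\<in>J. P x}. \<Sum>y\<in>{y\<in>J. P y}. cnj (c x) * c y * K x y)"
    using assms(1) by (simp add: sum.inter_filter if_distrib if_distribR cong: if_cong sum.cong)
      (rule sum.cong, simp_all)
  then show "(\<Sum>x\<in>J. \<Sum>y\<in>J. cnj (c x) * c y * (if P x \<and> P y then K x y else 0)) \<in> \<real>\<^sub>\<ge>\<^sub>0"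
    using positive_kernelD[OF assms(2)] by simp
qed

lemma positive_kernel_subset:
  assumes "finite J" "positive_kernel J K" "J' \<subseteq> J"
  shows "positive_kernel J' K"
  unfolding positive_kernel_def
proof
  fix c :: "'a \<Rightarrow> complex"
  let ?d = "\<lambda>x. if x \<in> J' then c x else 0"
  have "(\<Sum>x\<in>J'. \<Sum>y\<in>J'. cnj (c x) * c y * K x y) = (\<Sum>x\<in>J'. \<Sum>y\<in>J'. cnj (?d x) * ?d y * K x y)"
    by (intro sum.cong) auto
  also have "\<dots> = (\<Sum>x\<in>J'. \<Sum>y\<in>J. cnj (?d x) * ?d y * K x y)"
    using assms by (intro sum.cong sum.mono_neutral_left) auto
  also have "\<dots> = (\<Sum>x\<in>J. \<Sum>y\<in>J. cnj (?d x) * ?d y * K x y)"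
    using assms by (intro sum.mono_neutral_left) auto
  finally show "(\<Sum>x\<in>J'. \<Sum>y\<in>J'. cnj (c x) * c y * K x y) \<in> \<real>\<^sub>\<ge>\<^sub>0"
    using positive_kernelD[OF assms(2)] by simp
qed

lemma positive_kernel_diag:
  assumes "finite J" "positive_kernel J K" "x \<in> J"
  shows "K x x \<in> \<real>\<^sub>\<ge>\<^sub>0"
  using positive_kernelD[OF positive_kernel_subset[OF assms(1,2), of "{x}"], of "\<lambda>_. 1"] assms(3)
  by simp

lemma positive_kernel_two_points:
  assumes "finite J" "positive_kernel J K" "x \<in> J" "y \<in> J" "x \<noteq> y"
  shows "cnj a * a * K x x + cnj a * b * K x y + (cnj b * a * K y x + cnj b * b * K y y) \<in> \<real>\<^sub>\<ge>\<^sub>0"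
  using positive_kernelD[OF positive_kernel_subset[OF assms(1,2), of "{x,y}"],
      of "\<lambda>z. if z = x then a else b"] assms(3-5)
  by simp

text \<open>
  By polarisation: the values of the quadratic form at the coefficients \<open>(1, 1)\<close> and \<open>(1, \<i>)\<close> are real,
  which determines the real and the imaginary part of \<open>K y x\<close>.
\<close>

lemma positive_kernel_hermitian:
  assumes "finite J" "positive_kernel J K" "x \<in> J" "y \<in> J"
  shows "K y x = cnj (K x y)"
proof (cases "x = y")
  case True
  then show ?thesis
    using positive_kernel_diag[OF assms(1-3)] by (simp add: complex_nonneg_Reals_iff complex_eq_iff)
next
  case False
  have "Im (K x x) = 0" "Im (K y y) = 0"
    using positive_kernel_diag[OF assms(1,2)] assms(3,4) by (simp_all add: complex_nonneg_Reals_iff)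
  moreover note positive_kernel_two_points[OF assms False, of 1 1]
    positive_kernel_two_points[OF assms False, of 1 \<i>]
  ultimately show ?thesis
    by (simp add: complex_nonneg_Reals_iff complex_eq_iff)
qed

text \<open>
  The degenerate case of the Cauchy-Schwarz inequality.
\<close>

lemma positive_kernel_null:
  assumes "finite J" "positive_kernel J K" "x \<in> J" "y \<in> J" "K x x = 0"
  shows "K x y = 0"
proof (rule ccontr)
  assume nz: "K x y \<noteq> 0"
  then have "x \<noteq> y" using assms(5) by auto
  define r where "r = (cmod (K x y))\<^sup>2"
  have r: "r > 0" using nz by (simp add: r_def)
  have prod: "K x y * cnj (K x y) = complex_of_real r"
    unfolding r_def by (rule complex_norm_square[symmetric])
  \<comment> \<open>a large multiple of \<open>K x y\<close> as coefficient at \<open>x\<close> makes the cross terms dominate\<close>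
  define t where "t = (Re (K y y) + 1) / (2 * r)"
  have eq: "cnj (- of_real t * K x y) * (- of_real t * K x y) * K x x
      + cnj (- of_real t * K x y) * 1 * K x y
      + (cnj 1 * (- of_real t * K x y) * K y x + cnj 1 * 1 * K y y)
    = - (2 * of_real t * of_real r) + K y y"
    using assms(5) positive_kernel_hermitian[OF assms(1-4)]
    by (simp add: prod[symmetric] algebra_simps)
  have "- (2 * t * r) + Re (K y y) \<ge> 0"
    using positive_kernel_two_points[OF assms(1-4) \<open>x \<noteq> y\<close>, of "- of_real t * K x y" 1]
    unfolding eq by (simp add: complex_nonneg_Reals_iff)
  then show False using r by (simp add: t_def)
qed

text \<open>
  The form of the Schur complement is the minimum of the form of \<open>K\<close> over all choices of the
  coefficient at \<open>p\<close>.  If \<open>K p p = 0\<close>, then the quotient is \<open>0\<close> and the complement is \<open>K\<close> itself.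
\<close>

lemma positive_kernel_schur_complement:
  assumes "finite J" "p \<notin> J" "positive_kernel (insert p J) K"
  shows "positive_kernel J (\<lambda>x y. K x y - K x p * K p y / K p p)"
proof (cases "K p p = 0")
  case True
  then show ?thesis
    using positive_kernel_subset[of "insert p J" K J] assms by auto
next
  case False
  define k where "k = Re (K p p)"
  have k: "K p p = of_real k" "k \<noteq> 0"
    using positive_kernel_diag[OF _ assms(3), of p] assms(1) False
    by (auto simp: complex_nonneg_Reals_iff k_def complex_eq_iff)
  show ?thesis
    unfolding positive_kernel_def
  proof
    fix c :: "'a \<Rightarrow> complex"
    define s where "s = (\<Sum>y\<in>J. c y * K p y)"
    have s_cnj: "(\<Sum>x\<in>J. cnj (c x) * K x p) = cnj s"
      unfolding s_def cnj_sum using assms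
      by (intro sum.cong) (auto simp: positive_kernel_hermitian[OF _ assms(3), of _ p])
    let ?Q = "\<Sum>x\<in>J. \<Sum>y\<in>J. cnj (c x) * c y * K x y"
    \<comment> \<open>the coefficient at \<open>p\<close> that minimises the form when the others are given\<close>
    define d where "d = (\<lambda>x. if x = p then - s / of_real k else c x)"
    have d: "d p = - s / of_real k" "\<And>x. x \<in> J \<Longrightarrow> d x = c x"
      using assms(2) by (auto simp: d_def)
    have split: "(\<Sum>x\<in>insert p J. \<Sum>y\<in>insert p J. cnj (d x) * d y * K x y)
       = cnj (d p) * d p * K p p + cnj (d p) * (\<Sum>y\<in>J. c y * K p y)
         + (d p * (\<Sum>x\<in>J. cnj (c x) * K x p) + ?Q)"
      using assms(1,2)
      by (simp add: sum.distrib d(2) sum_distrib_left mult_ac cong: sum.cong)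
    have "(\<Sum>x\<in>insert p J. \<Sum>y\<in>insert p J. cnj (d x) * d y * K x y) = ?Q - cnj s * s / of_real k"
      unfolding split s_cnj s_def[symmetric] unfolding d(1) k(1) using k(2)
      by (simp add: field_simps)
    also have "\<dots> = (\<Sum>x\<in>J. \<Sum>y\<in>J. cnj (c x) * c y * (K x y - K x p * K p y / K p p))"
      unfolding s_cnj[symmetric] unfolding s_def sum_product k(1)
      by (simp add: right_diff_distrib sum_subtractf sum_divide_distrib mult_ac)
    finally show "(\<Sum>x\<in>J. \<Sum>y\<in>J. cnj (c x) * c y * (K x y - K x p * K p y / K p p)) \<in> \<real>\<^sub>\<ge>\<^sub>0"
      using positive_kernelD[OF assms(3), of d] by simp
  qed
qed

text \<open>
  The Schur product theorem, by removing one point \<open>p\<close> at a time: \<open>K\<close> is the sum of its Schur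
  complement at \<open>p\<close>, which has zero row and column at \<open>p\<close> and so is covered by the induction
  hypothesis, and a kernel of rank one, multiplication by which only rescales the coefficients.
\<close>

theorem positive_kernel_mult:
  assumes "finite J" "positive_kernel J K" "positive_kernel J L"
  shows "positive_kernel J (\<lambda>x y. K x y * L x y)"
  using assms
proof (induction J arbitrary: K L)
  case empty
  then show ?case by (simp add: positive_kernel_def)
next
  case (insert p J)
  let ?J = "insert p J"
  have fin: "finite ?J" using insert.hyps by simp
  note K = insert.prems(1) and L = insert.prems(2)
  define K' where "K' = (\<lambda>x y. K x y - K x p * K p y / K p p)"
  have null: "K p x = 0" "K x p = 0" if "x \<in> ?J" "K p p = 0" for x
    using positive_kernel_null[OF fin K, of p x] positive_kernel_hermitian[OF fin K, of p x] that
    by auto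
  \<comment> \<open>if \<open>K p p = 0\<close>, then the row of \<open>K\<close> at \<open>p\<close> vanishes and the convention \<open>x / 0 = 0\<close> gives \<open>K' = K\<close>\<close>
  have K'_p: "K' p x = 0" "K' x p = 0" if "x \<in> ?J" for x
    using null[OF that] by (cases "K p p = 0"; simp add: K'_def)+
  have "positive_kernel J (\<lambda>x y. K' x y * L x y)"
    unfolding K'_def
    by (intro insert.IH positive_kernel_schur_complement insert.hyps K
        positive_kernel_subset[OF fin L]) auto
  moreover have "{x \<in> ?J. x \<in> J} = J" by auto
  ultimately have "positive_kernel ?J (\<lambda>x y. if x \<in> J \<and> y \<in> J then K' x y * L x y else 0)"
    by (intro positive_kernel_extend_by_zero fin) simp
  then have 1: "positive_kernel ?J (\<lambda>x y. K' x y * L x y)"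
    by (rule positive_kernel_cong[THEN iffD1, rotated]) (auto simp: K'_p)
  \<comment> \<open>the vector of which the rank-one part of \<open>K\<close> is the square\<close>
  define g where "g = (\<lambda>y. K p y / of_real (sqrt (Re (K p p))))"
  have "K p p \<in> \<real>\<^sub>\<ge>\<^sub>0" using positive_kernel_diag[OF fin K] by simp
  then have k: "of_real (sqrt (Re (K p p))) * of_real (sqrt (Re (K p p))) = K p p"
    by (simp add: complex_nonneg_Reals_iff complex_eq_iff flip: of_real_mult)
  have "cnj (g x) * g y = K x p * K p y / K p p" if "x \<in> ?J" for x y
    using positive_kernel_hermitian[OF fin K, of p x] that
    by (simp add: g_def k)
  then have 2: "positive_kernel ?J (\<lambda>x y. K x p * K p y / K p p * L x y)"
    by (intro positive_kernel_cong[THEN iffD1, OF _ positive_kernel_scale[OF L, of g]]) simp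
  show ?case
    by (rule positive_kernel_cong[THEN iffD1, OF _ positive_kernel_add[OF 1 2]])
      (simp add: K'_def algebra_simps)
qed

section \<open>Complex algebras and sesquilinear forms\<close>

lemma complex_ring_cring: "cring complex_ring"
  by (rule cringI, rule abelian_groupI)
    (auto simp: complex_ring_def algebra_simps intro!: comm_monoidI exI[of _ "- _ :: complex"])

lemma complex_ring_simps [simp]:
  "carrier complex_ring = UNIV" "mult complex_ring = (*)" "add complex_ring = (+)"
  "one complex_ring = 1" "zero complex_ring = 0"
  by (simp_all add: complex_ring_def)

lemma complex_algebraI:
  assumes "ring A"
    and "\<And>c x. x \<in> carrier A \<Longrightarrow> c \<odot>\<^bsub>A\<^esub> x \<in> carrier A"
    and "\<And>c d x. x \<in> carrier A \<Longrightarrow> (c + d) \<odot>\<^bsub>A\<^esub> x = c \<odot>\<^bsub>A\<^esub> x \<oplus>\<^bsub>A\<^esub> d \<odot>\<^bsub>A\<^esub> x"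
    and "\<And>c x y. x \<in> carrier A \<Longrightarrow> y \<in> carrier A \<Longrightarrow>
      c \<odot>\<^bsub>A\<^esub> (x \<oplus>\<^bsub>A\<^esub> y) = c \<odot>\<^bsub>A\<^esub> x \<oplus>\<^bsub>A\<^esub> c \<odot>\<^bsub>A\<^esub> y"
    and "\<And>c d x. x \<in> carrier A \<Longrightarrow> (c * d) \<odot>\<^bsub>A\<^esub> x = c \<odot>\<^bsub>A\<^esub> (d \<odot>\<^bsub>A\<^esub> x)"
    and "\<And>x. x \<in> carrier A \<Longrightarrow> 1 \<odot>\<^bsub>A\<^esub> x = x"
    and "\<And>c x y. x \<in> carrier A \<Longrightarrow> y \<in> carrier A \<Longrightarrow>
      (c \<odot>\<^bsub>A\<^esub> x) \<otimes>\<^bsub>A\<^esub> y = c \<odot>\<^bsub>A\<^esub> (x \<otimes>\<^bsub>A\<^esub> y)"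
    and "\<And>c x y. x \<in> carrier A \<Longrightarrow> y \<in> carrier A \<Longrightarrow>
      x \<otimes>\<^bsub>A\<^esub> (c \<odot>\<^bsub>A\<^esub> y) = c \<odot>\<^bsub>A\<^esub> (x \<otimes>\<^bsub>A\<^esub> y)"
  shows "complex_algebra A"
proof -
  interpret ring A by fact
  show ?thesis
    by (intro complex_algebra.intro complex_algebra_axioms.intro moduleI complex_ring_cring
        abelian_group_axioms assms(1)) (simp_all add: assms is_abelian_group)
qed

lemma complex_algebra_restrict:
  assumes "complex_algebra A" "complex_subalgebra S A"
  shows "complex_algebra (A\<lparr>carrier := S\<rparr>)"
proof -
  interpret complex_algebra A by fact
  have S: "subring S A" "submodule S complex_ring A"
    using assms(2) by (auto simp: complex_subalgebra_def)
  then have "S \<subseteq> carrier A" by (simp add: subringE(1))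
  then show ?thesis
    using submodule.smult_closed[OF S(2)] smult_l_distr smult_r_distr smult_assoc1 smult_one
      smult_mult_left smult_mult_right
    by (intro complex_algebraI subring_is_ring[OF S(1)]) (auto simp: subset_iff)
qed

definition algebra_hom :: "'a calg \<Rightarrow> 'b calg \<Rightarrow> ('a \<Rightarrow> 'b) set" where
  "algebra_hom A B =
     {h \<in> ring_hom A B. \<forall>c. \<forall>x\<in>carrier A. h (c \<odot>\<^bsub>A\<^esub> x) = c \<odot>\<^bsub>B\<^esub> h x}"

lemma algebra_homD:
  assumes "h \<in> algebra_hom A B"
  shows "\<And>x. x \<in> carrier A \<Longrightarrow> h x \<in> carrier B"
    and "\<And>x y. x \<in> carrier A \<Longrightarrow> y \<in> carrier A \<Longrightarrow> h (x \<otimes>\<^bsub>A\<^esub> y) = h x \<otimes>\<^bsub>B\<^esub> h y"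
    and "\<And>x y. x \<in> carrier A \<Longrightarrow> y \<in> carrier A \<Longrightarrow> h (x \<oplus>\<^bsub>A\<^esub> y) = h x \<oplus>\<^bsub>B\<^esub> h y"
    and "h \<one>\<^bsub>A\<^esub> = \<one>\<^bsub>B\<^esub>"
    and "\<And>c x. x \<in> carrier A \<Longrightarrow> h (c \<odot>\<^bsub>A\<^esub> x) = c \<odot>\<^bsub>B\<^esub> h x"
  using assms by (auto simp: algebra_hom_def ring_hom_def)

text \<open>
  The coefficients belong to the labels in \<open>S\<close> and not to the vectors \<open>p w\<close>, so that an element of a
  free product can be written with coefficients on words even if different words have equal products.
\<close>

definition linear_combinations :: "(complex, 'a, 'x) module_scheme \<Rightarrow> ('w \<Rightarrow> 'a) \<Rightarrow> 'w set \<Rightarrow> 'a set" where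
  "linear_combinations A p S =
     {(\<Oplus>\<^bsub>A\<^esub>w\<in>F. c w \<odot>\<^bsub>A\<^esub> p w) | c F. finite F \<and> F \<subseteq> S}"

lemma linear_combinationsI:
  assumes "finite F" "F \<subseteq> S" "x = (\<Oplus>\<^bsub>A\<^esub>w\<in>F. c w \<odot>\<^bsub>A\<^esub> p w)"
  shows "x \<in> linear_combinations A p S"
  using assms unfolding linear_combinations_def by blast

lemma linear_combinationsE:
  assumes "x \<in> linear_combinations A p S"
  obtains c F where "finite F" "F \<subseteq> S" "x = (\<Oplus>\<^bsub>A\<^esub>w\<in>F. c w \<odot>\<^bsub>A\<^esub> p w)"
  using assms unfolding linear_combinations_def by blast

lemma (in complex_algebra) linear_combinations_generator:
  assumes "w \<in> S" "p w \<in> carrier A"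
  shows "p w \<in> linear_combinations A p S"
proof -
  have "p w = (\<Oplus>v\<in>{w}. 1 \<odot> p v)" using assms(2) smult_one[of "p w"] by simp
  then show ?thesis
    by (rule linear_combinationsI[rotated -1]) (use assms(1) in simp_all)
qed

lemma (in complex_algebra) linear_combinations_submodule:
  assumes "\<And>w. w \<in> S \<Longrightarrow> p w \<in> carrier A"
  shows "submodule (linear_combinations A p S) complex_ring A" (is "submodule ?H _ _")
proof -
  have smult: "d \<odot> x \<in> ?H" if "x \<in> ?H" for d x
  proof -
    obtain c F where F: "finite F" "F \<subseteq> S" and x: "x = (\<Oplus>w\<in>F. c w \<odot> p w)"
      using \<open>x \<in> ?H\<close> by (rule linear_combinationsE)
    have "d \<odot> x = (\<Oplus>w\<in>F. d \<odot> (c w \<odot> p w))"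
      unfolding x using F assms by (intro finsum_smult_ldistr) auto
    also have "\<dots> = (\<Oplus>w\<in>F. (d * c w) \<odot> p w)"
      using F assms smult_assoc1 by (intro finsum_cong') auto
    finally show ?thesis
      using F by (intro linear_combinationsI)
  qed
  have add: "x \<oplus> y \<in> ?H" if "x \<in> ?H" "y \<in> ?H" for x y
  proof -
    obtain c F where F: "finite F" "F \<subseteq> S" and x: "x = (\<Oplus>w\<in>F. c w \<odot> p w)"
      using \<open>x \<in> ?H\<close> by (rule linear_combinationsE)
    obtain d G where G: "finite G" "G \<subseteq> S" and y: "y = (\<Oplus>w\<in>G. d w \<odot> p w)"
      using \<open>y \<in> ?H\<close> by (rule linear_combinationsE)
    \<comment> \<open>to add the two combinations, both are extended by zero coefficients to \<open>F \<union> G\<close>\<close>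
    let ?c = "\<lambda>w. if w \<in> F then c w else 0" and ?d = "\<lambda>w. if w \<in> G then d w else 0"
    have p: "p w \<in> carrier A" if "w \<in> F \<union> G" for w using that F G assms by blast
    have null: "0 \<odot> p w = \<zero>" if "w \<in> F \<union> G" for w using smult_l_null[of "p w"] p[OF that] by simp
    have "x = (\<Oplus>w\<in>F \<union> G. ?c w \<odot> p w)"
      unfolding x using F G p null
      by (intro add.finprod_mono_neutral_cong_left) auto
    moreover have "y = (\<Oplus>w\<in>F \<union> G. ?d w \<odot> p w)"
      unfolding y using F G p null
      by (intro add.finprod_mono_neutral_cong_left) auto
    moreover have "(\<Oplus>w\<in>F \<union> G. ?c w \<odot> p w) \<oplus> (\<Oplus>w\<in>F \<union> G. ?d w \<odot> p w)
      = (\<Oplus>w\<in>F \<union> G. ?c w \<odot> p w \<oplus> ?d w \<odot> p w)"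
      using p by (intro finsum_addf[symmetric]) auto
    moreover have "\<dots> = (\<Oplus>w\<in>F \<union> G. (?c w + ?d w) \<odot> p w)"
      using p smult_l_distr by (intro finsum_cong') auto
    ultimately have sum: "x \<oplus> y = (\<Oplus>w\<in>F \<union> G. (?c w + ?d w) \<odot> p w)"
      by metis
    then show ?thesis
      using F G by (intro linear_combinationsI[OF _ _ sum]) auto
  qed
  have sub: "?H \<subseteq> carrier A"
    using assms by (auto simp: linear_combinations_def intro!: finsum_closed)
  show ?thesis
  proof (rule submoduleI[OF sub])
    show "\<zero> \<in> ?H"
      by (rule linear_combinationsI[of "{}"]) simp_all
    fix x assume "x \<in> ?H"
    with sub smult_l_minus[of 1 x] smult_one[of x] have "\<ominus> x = (- 1) \<odot> x"
      using R.minus_equality[of "-1" 1] by auto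
    with smult[OF \<open>x \<in> ?H\<close>] show "\<ominus> x \<in> ?H" by simp
  qed (use add smult in auto)
qed

lemma (in complex_algebra) linear_combinations_minimal:
  assumes H: "submodule H complex_ring A" and gen: "\<And>w. w \<in> S \<Longrightarrow> p w \<in> H"
    and carr: "H \<subseteq> carrier A"
  shows "linear_combinations A p S \<subseteq> H"
proof
  interpret H: submodule H complex_ring A by (rule H)
  fix x assume "x \<in> linear_combinations A p S"
  then obtain c F where F: "finite F" "F \<subseteq> S" and x: "x = (\<Oplus>w\<in>F. c w \<odot> p w)"
    by (rule linear_combinationsE)
  have p: "p w \<in> carrier A" if "w \<in> S" for w using gen[OF that] carr by blast
  from F have "(\<Oplus>w\<in>F. c w \<odot> p w) \<in> H"
  proof (induction F)
    case empty
    then show ?case using H.one_closed by simp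
  next
    case (insert w F)
    then have "(\<Oplus>w\<in>insert w F. c w \<odot> p w) = c w \<odot> p w \<oplus> (\<Oplus>w\<in>F. c w \<odot> p w)"
      using p by (intro finsum_insert) auto
    then show ?case using insert gen H.smult_closed[of "c w"] H.m_closed by simp
  qed
  then show "x \<in> H" unfolding x .
qed

definition sesquilinear_form :: "(complex, 'a, 'x) module_scheme \<Rightarrow> ('a \<Rightarrow> 'a \<Rightarrow> complex) \<Rightarrow> bool" where
  "sesquilinear_form A s \<longleftrightarrow>
     (\<forall>x\<in>carrier A. \<forall>y\<in>carrier A. \<forall>z\<in>carrier A.
        s (x \<oplus>\<^bsub>A\<^esub> y) z = s x z + s y z \<and> s z (x \<oplus>\<^bsub>A\<^esub> y) = s z x + s z y) \<and>
     (\<forall>c. \<forall>x\<in>carrier A. \<forall>y\<in>carrier A.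
        s (c \<odot>\<^bsub>A\<^esub> x) y = cnj c * s x y \<and> s x (c \<odot>\<^bsub>A\<^esub> y) = c * s x y)"

lemma (in complex_algebra) sesquilinear_form_finsum:
  assumes s: "sesquilinear_form A s" and "finite J"
    and a: "\<And>j. j \<in> J \<Longrightarrow> a j \<in> carrier A"
  shows "s (\<Oplus>j\<in>J. c j \<odot> a j) (\<Oplus>j\<in>J. c j \<odot> a j) =
    (\<Sum>x\<in>J. \<Sum>y\<in>J. cnj (c x) * c y * s (a x) (a y))"
proof -
  have zero: "s \<zero> y = 0" "s y \<zero> = 0" if "y \<in> carrier A" for y
    using s that zero_closed l_zero[of "\<zero>"] unfolding sesquilinear_form_def
    by (metis add_cancel_right_right)+
  have right: "s x (\<Oplus>j\<in>K. c j \<odot> a j) = (\<Sum>j\<in>K. c j * s x (a j))"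
    if "finite K" "K \<subseteq> J" "x \<in> carrier A" for K x
    using that
  proof (induction K)
    case (insert k K)
    then have "(\<Oplus>j\<in>K. c j \<odot> a j) \<in> carrier A" "(\<Oplus>j\<in>insert k K. c j \<odot> a j)
       = c k \<odot> a k \<oplus> (\<Oplus>j\<in>K. c j \<odot> a j)"
      using a by (auto intro!: finsum_closed finsum_insert)
    with insert a s show ?case by (simp add: sesquilinear_form_def)
  qed (simp add: zero)
  have "s (\<Oplus>j\<in>K. c j \<odot> a j) y = (\<Sum>j\<in>K. cnj (c j) * s (a j) y)"
    if "finite K" "K \<subseteq> J" "y \<in> carrier A" for K y
    using that
  proof (induction K)
    case (insert k K)
    then have "(\<Oplus>j\<in>K. c j \<odot> a j) \<in> carrier A" "(\<Oplus>j\<in>insert k K. c j \<odot> a j)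
       = c k \<odot> a k \<oplus> (\<Oplus>j\<in>K. c j \<odot> a j)"
      using a by (auto intro!: finsum_closed finsum_insert)
    with insert a s show ?case by (simp add: sesquilinear_form_def)
  qed (simp add: zero)
  from this[of J "\<Oplus>j\<in>J. c j \<odot> a j"] have
    "s (\<Oplus>j\<in>J. c j \<odot> a j) (\<Oplus>j\<in>J. c j \<odot> a j)
      = (\<Sum>x\<in>J. cnj (c x) * s (a x) (\<Oplus>j\<in>J. c j \<odot> a j))"
    using a \<open>finite J\<close> by (auto intro!: finsum_closed)
  also have "\<dots> = (\<Sum>x\<in>J. \<Sum>y\<in>J. cnj (c x) * c y * s (a x) (a y))"
    using a \<open>finite J\<close> by (simp add: right sum_distrib_left mult.assoc)
  finally show ?thesis .
qed

lemma reflection_form_sesquilinear: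
  assumes "complex_algebra B" "antilinear_hom B B \<theta>" "linear_functional B \<tau>"
  shows "sesquilinear_form B (\<lambda>x y. \<tau> (\<theta> x \<otimes>\<^bsub>B\<^esub> y))"
proof -
  interpret complex_algebra B by fact
  have "\<theta> \<in> ring_hom B B" and anti: "\<And>c x. x \<in> carrier B \<Longrightarrow> \<theta> (c \<odot>\<^bsub>B\<^esub> x) = cnj c \<odot>\<^bsub>B\<^esub> \<theta> x"
    using assms(2) by (auto simp: antilinear_hom_def)
  note \<theta> = ring_hom_memE[OF this(1)] anti
  show ?thesis
    using assms(3) \<theta>
    by (simp add: sesquilinear_form_def linear_functional_def l_distr r_distr
        smult_mult_left smult_mult_right)
qed

lemma sesquilinear_form_pullback:
  assumes "sesquilinear_form B s" "h \<in> algebra_hom A B"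
  shows "sesquilinear_form A (\<lambda>x y. s (h x) (h y))"
  using assms(1) algebra_homD[OF assms(2)] by (simp add: sesquilinear_form_def)

text \<open>
  A Gram matrix is positive semidefinite, because its quadratic form at \<open>c\<close> is the value of \<open>s\<close> at
  the vector \<open>\<Sum>j\<in>J. c j \<odot> a j\<close>.  The subspace \<open>H\<close> is there because reflection positivity only speaks
  about the positive part of an algebra.
\<close>

lemma (in complex_algebra) positive_kernel_of_form:
  assumes s: "sesquilinear_form A s" and H: "submodule H complex_ring A" "H \<subseteq> carrier A"
    and pos: "\<And>x. x \<in> H \<Longrightarrow> s x x \<in> \<real>\<^sub>\<ge>\<^sub>0"
    and J: "finite J" "\<And>j. j \<in> J \<Longrightarrow> a j \<in> H"
  shows "positive_kernel J (\<lambda>x y. s (a x) (a y))"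
  unfolding positive_kernel_def
proof
  fix c
  have "(\<Oplus>j\<in>J. c j \<odot> a j) \<in> linear_combinations A a J"
    using J(1) by (rule linear_combinationsI) simp_all
  then have "(\<Oplus>j\<in>J. c j \<odot> a j) \<in> H"
    by (rule subsetD[OF linear_combinations_minimal[OF H(1) _ H(2)], rotated -1]) (rule J(2))
  then have "s (\<Oplus>j\<in>J. c j \<odot> a j) (\<Oplus>j\<in>J. c j \<odot> a j) \<in> \<real>\<^sub>\<ge>\<^sub>0"
    by (rule pos)
  also have "s (\<Oplus>j\<in>J. c j \<odot> a j) (\<Oplus>j\<in>J. c j \<odot> a j)
      = (\<Sum>x\<in>J. \<Sum>y\<in>J. cnj (c x) * c y * s (a x) (a y))"
    by (rule sesquilinear_form_finsum[OF s J(1)]) (rule subsetD[OF H(2) J(2)])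
  finally show "(\<Sum>x\<in>J. \<Sum>y\<in>J. cnj (c x) * c y * s (a x) (a y)) \<in> \<real>\<^sub>\<ge>\<^sub>0" .
qed

lemma list_product_simps [simp]:
  "list_product G [] = \<one>\<^bsub>G\<^esub>"
  "list_product G (x # xs) = x \<otimes>\<^bsub>G\<^esub> list_product G xs"
  by (simp_all add: list_product_def)

lemma (in monoid) list_product_closed:
  "set xs \<subseteq> carrier G \<Longrightarrow> list_product G xs \<in> carrier G"
  by (induction xs) auto

lemma (in monoid) list_product_append:
  "set xs \<subseteq> carrier G \<Longrightarrow> set ys \<subseteq> carrier G \<Longrightarrow>
     list_product G (xs @ ys) = list_product G xs \<otimes> list_product G ys"
  by (induction xs) (auto simp: m_assoc list_product_closed)

lemma ring_hom_list_product:
  assumes "h \<in> ring_hom R S" "ring R" "set xs \<subseteq> carrier R"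
  shows "h (list_product R xs) = list_product S (map h xs)"
proof -
  interpret ring R by fact
  show ?thesis
    using assms(3) by (induction xs)
      (simp_all add: ring_hom_one[OF assms(1)] ring_hom_mult[OF assms(1)] list_product_closed)
qed

section \<open>Monoid algebras and quotients\<close>

lemma monoid_algebra_simps [simp]:
  "f \<in> carrier (monoid_algebra M) \<longleftrightarrow> finite {m. f m \<noteq> 0} \<and> {m. f m \<noteq> 0} \<subseteq> carrier M"
  "\<zero>\<^bsub>monoid_algebra M\<^esub> = (\<lambda>m. 0)"
  "\<one>\<^bsub>monoid_algebra M\<^esub> = basis_elem \<one>\<^bsub>M\<^esub>"
  "f \<oplus>\<^bsub>monoid_algebra M\<^esub> g = (\<lambda>m. f m + g m)"
  "c \<odot>\<^bsub>monoid_algebra M\<^esub> f = (\<lambda>m. c * f m)"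
  by (simp_all add: monoid_algebra_def basis_elem_def)

text \<open>
  The sum that defines the product ranges over a set that depends on the supports of both factors.
  Summing over fixed finite sets instead makes the product visibly bilinear.
\<close>

lemma monoid_algebra_mult_apply:
  assumes "finite X" "{x. f x \<noteq> 0} \<subseteq> X" "finite Y" "{y. g y \<noteq> 0} \<subseteq> Y"
  shows "(f \<otimes>\<^bsub>monoid_algebra M\<^esub> g) m =
    (\<Sum>x\<in>X. \<Sum>y\<in>Y. f x * g y * (if x \<otimes>\<^bsub>M\<^esub> y = m then 1 else 0))"
proof -
  have "(\<Sum>x\<in>X. \<Sum>y\<in>Y. f x * g y * (if x \<otimes>\<^bsub>M\<^esub> y = m then 1 else 0))
     = (\<Sum>(x, y)\<in>X \<times> Y. f x * g y * (if x \<otimes>\<^bsub>M\<^esub> y = m then 1 else 0))"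
    by (rule sum.cartesian_product)
  also have "\<dots> = (\<Sum>(x, y)\<in>{(x, y). f x \<noteq> 0 \<and> g y \<noteq> 0 \<and> x \<otimes>\<^bsub>M\<^esub> y = m}. f x * g y)"
    using assms by (intro sum.mono_neutral_cong_right) (auto split: if_splits)
  finally show ?thesis by (simp add: monoid_algebra_def)
qed

text \<open>
  Pairing with a test function \<open>\<phi>\<close> eliminates the product \<open>f \<otimes> g\<close>.  Both bracketings of a triple product
  reduce in this way to the same triple sum, which gives associativity.
\<close>

lemma monoid_algebra_mult_pairing:
  assumes "finite X" "{x. f x \<noteq> 0} \<subseteq> X" "finite Y" "{y. g y \<noteq> 0} \<subseteq> Y"
    and "finite Z" "\<And>x y. x \<in> X \<Longrightarrow> y \<in> Y \<Longrightarrow> x \<otimes>\<^bsub>M\<^esub> y \<in> Z"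
  shows "(\<Sum>m\<in>Z. (f \<otimes>\<^bsub>monoid_algebra M\<^esub> g) m * \<phi> m) =
    (\<Sum>x\<in>X. \<Sum>y\<in>Y. f x * g y * \<phi> (x \<otimes>\<^bsub>M\<^esub> y))"
proof -
  have "(\<Sum>m\<in>Z. (f \<otimes>\<^bsub>monoid_algebra M\<^esub> g) m * \<phi> m)
     = (\<Sum>m\<in>Z. \<Sum>x\<in>X. \<Sum>y\<in>Y. f x * g y * (if x \<otimes>\<^bsub>M\<^esub> y = m then \<phi> m else 0))"
    unfolding monoid_algebra_mult_apply[OF assms(1-4)] sum_distrib_right
    by (intro sum.cong) auto
  also have "\<dots> = (\<Sum>x\<in>X. \<Sum>y\<in>Y. \<Sum>m\<in>Z. f x * g y * (if x \<otimes>\<^bsub>M\<^esub> y = m then \<phi> m else 0))"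
    by (subst sum.swap, rule sum.cong[OF refl], rule sum.swap)
  also have "\<dots> = (\<Sum>x\<in>X. \<Sum>y\<in>Y. f x * g y * \<phi> (x \<otimes>\<^bsub>M\<^esub> y))"
    by (intro sum.cong refl) (simp add: sum_distrib_left[symmetric] assms(5,6))
  finally show ?thesis .
qed

lemma monoid_algebra_mult_support:
  assumes "(f \<otimes>\<^bsub>monoid_algebra M\<^esub> g) m \<noteq> 0"
  shows "\<exists>x y. f x \<noteq> 0 \<and> g y \<noteq> 0 \<and> m = x \<otimes>\<^bsub>M\<^esub> y"
proof (rule ccontr)
  assume "\<nexists>x y. f x \<noteq> 0 \<and> g y \<noteq> 0 \<and> m = x \<otimes>\<^bsub>M\<^esub> y"
  then have empty: "{(x, y). f x \<noteq> 0 \<and> g y \<noteq> 0 \<and> x \<otimes>\<^bsub>M\<^esub> y = m} = {}" by auto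
  have "(f \<otimes>\<^bsub>monoid_algebra M\<^esub> g) m =
      (\<Sum>(x, y)\<in>{(x, y). f x \<noteq> 0 \<and> g y \<noteq> 0 \<and> x \<otimes>\<^bsub>M\<^esub> y = m}. f x * g y)"
    by (simp add: monoid_algebra_def)
  then show False using assms unfolding empty by simp
qed

lemma monoid_algebra_mult_closed:
  assumes "monoid M" "f \<in> carrier (monoid_algebra M)" "g \<in> carrier (monoid_algebra M)"
  shows "f \<otimes>\<^bsub>monoid_algebra M\<^esub> g \<in> carrier (monoid_algebra M)"
proof -
  interpret monoid M by fact
  have "{m. (f \<otimes>\<^bsub>monoid_algebra M\<^esub> g) m \<noteq> 0}
      \<subseteq> (\<lambda>(x, y). x \<otimes>\<^bsub>M\<^esub> y) ` ({x. f x \<noteq> 0} \<times> {y. g y \<noteq> 0})"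
    using monoid_algebra_mult_support[of M f g] by fastforce
  moreover have "finite \<dots>" "\<dots> \<subseteq> carrier M" using assms(2,3) by auto
  ultimately show ?thesis
    by (simp add: finite_subset)
qed

lemma basis_elem_closed [simp]:
  assumes "x \<in> carrier M"
  shows "basis_elem x \<in> carrier (monoid_algebra M)"
  using assms by (simp add: basis_elem_def)

lemma basis_elem_mult:
  "basis_elem x \<otimes>\<^bsub>monoid_algebra M\<^esub> basis_elem y = basis_elem (x \<otimes>\<^bsub>M\<^esub> y)"
  by (rule ext, subst monoid_algebra_mult_apply[of "{x}" _ "{y}"]) (auto simp: basis_elem_def)

lemma monoid_algebra_mult_assoc:
  assumes "monoid M" "f \<in> carrier (monoid_algebra M)" "g \<in> carrier (monoid_algebra M)"
    "h \<in> carrier (monoid_algebra M)"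
  shows "(f \<otimes>\<^bsub>monoid_algebra M\<^esub> g) \<otimes>\<^bsub>monoid_algebra M\<^esub> h =
    f \<otimes>\<^bsub>monoid_algebra M\<^esub> (g \<otimes>\<^bsub>monoid_algebra M\<^esub> h)"
proof
  fix m
  interpret monoid M by fact
  let ?R = "monoid_algebra M"
  define X Y W where "X = {x. f x \<noteq> 0}" and "Y = {x. g x \<noteq> 0}" and "W = {x. h x \<noteq> 0}"
  note XYW = X_def[symmetric] Y_def[symmetric] W_def[symmetric]
  have fin: "finite X" "finite Y" "finite W" and sub: "X \<subseteq> carrier M" "Y \<subseteq> carrier M" "W \<subseteq> carrier M"
    using assms(2-4) by (auto simp: X_def Y_def W_def)
  define U V where "U = (\<lambda>(x, y). x \<otimes>\<^bsub>M\<^esub> y) ` (X \<times> Y)" and "V = (\<lambda>(x, y). x \<otimes>\<^bsub>M\<^esub> y) ` (Y \<times> W)"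
  have U: "finite U" "{u. (f \<otimes>\<^bsub>?R\<^esub> g) u \<noteq> 0} \<subseteq> U"
    using monoid_algebra_mult_support[of M f g] fin by (fastforce simp: U_def X_def Y_def)+
  have V: "finite V" "{u. (g \<otimes>\<^bsub>?R\<^esub> h) u \<noteq> 0} \<subseteq> V"
    using monoid_algebra_mult_support[of M g h] fin by (fastforce simp: V_def Y_def W_def)+
  have "((f \<otimes>\<^bsub>?R\<^esub> g) \<otimes>\<^bsub>?R\<^esub> h) m
     = (\<Sum>u\<in>U. (f \<otimes>\<^bsub>?R\<^esub> g) u * (\<Sum>w\<in>W. h w * (if u \<otimes>\<^bsub>M\<^esub> w = m then 1 else 0)))"
    using U fin by (subst monoid_algebra_mult_apply[of U _ W])
      (auto simp: W_def sum_distrib_left mult.assoc)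
  also have "\<dots> = (\<Sum>x\<in>X. \<Sum>y\<in>Y. f x * g y *
      (\<Sum>w\<in>W. h w * (if (x \<otimes>\<^bsub>M\<^esub> y) \<otimes>\<^bsub>M\<^esub> w = m then 1 else 0)))"
    using U fin by (intro monoid_algebra_mult_pairing) (auto simp: U_def X_def Y_def)
  also have "\<dots> = (\<Sum>x\<in>X. f x *
      (\<Sum>y\<in>Y. \<Sum>w\<in>W. g y * h w * (if x \<otimes>\<^bsub>M\<^esub> (y \<otimes>\<^bsub>M\<^esub> w) = m then 1 else 0)))"
    unfolding sum_distrib_left mult.assoc using sub
    by (intro sum.cong refl) (simp add: subset_iff m_assoc)
  also have "\<dots> = (\<Sum>x\<in>X. f x *
      (\<Sum>v\<in>V. (g \<otimes>\<^bsub>?R\<^esub> h) v * (if x \<otimes>\<^bsub>M\<^esub> v = m then 1 else 0)))"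
    using V fin
    by (intro sum.cong refl arg_cong2[where f = "(*)"] monoid_algebra_mult_pairing[symmetric])
      (auto simp: V_def Y_def W_def)
  also have "\<dots> = (f \<otimes>\<^bsub>?R\<^esub> (g \<otimes>\<^bsub>?R\<^esub> h)) m"
    using V fin by (subst monoid_algebra_mult_apply[of X _ V])
      (auto simp: X_def sum_distrib_left mult.assoc)
  finally show "((f \<otimes>\<^bsub>?R\<^esub> g) \<otimes>\<^bsub>?R\<^esub> h) m = (f \<otimes>\<^bsub>?R\<^esub> (g \<otimes>\<^bsub>?R\<^esub> h)) m" .
qed

lemma monoid_algebra_mult_one:
  assumes "monoid M" "f \<in> carrier (monoid_algebra M)"
  shows "basis_elem \<one>\<^bsub>M\<^esub> \<otimes>\<^bsub>monoid_algebra M\<^esub> f = f"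
    and "f \<otimes>\<^bsub>monoid_algebra M\<^esub> basis_elem \<one>\<^bsub>M\<^esub> = f"
proof -
  interpret monoid M by fact
  have f: "finite {x. f x \<noteq> 0}" "{x. f x \<noteq> 0} \<subseteq> carrier M" using assms by auto
  have delta: "(\<Sum>x\<in>{x. f x \<noteq> 0}. f x * (if x = m then 1 else 0)) = f m" for m
    using f(1) by (simp add: if_distrib cong: if_cong)
  have basis: "{y. basis_elem \<one>\<^bsub>M\<^esub> y \<noteq> (0::complex)} \<subseteq> {\<one>\<^bsub>M\<^esub>}" by (auto simp: basis_elem_def)
  show "basis_elem \<one>\<^bsub>M\<^esub> \<otimes>\<^bsub>monoid_algebra M\<^esub> f = f"
  proof
    fix m
    have "(basis_elem \<one>\<^bsub>M\<^esub> \<otimes>\<^bsub>monoid_algebra M\<^esub> f) m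
        = (\<Sum>x\<in>{x. f x \<noteq> 0}. f x * (if \<one>\<^bsub>M\<^esub> \<otimes>\<^bsub>M\<^esub> x = m then 1 else 0))"
      using f basis by (subst monoid_algebra_mult_apply[of "{\<one>\<^bsub>M\<^esub>}" _ "{x. f x \<noteq> 0}"])
        (auto simp: basis_elem_def)
    also have "\<dots> = (\<Sum>x\<in>{x. f x \<noteq> 0}. f x * (if x = m then 1 else 0))"
      using f by (intro sum.cong) auto
    finally show "(basis_elem \<one>\<^bsub>M\<^esub> \<otimes>\<^bsub>monoid_algebra M\<^esub> f) m = f m" using delta by simp
  qed
  show "f \<otimes>\<^bsub>monoid_algebra M\<^esub> basis_elem \<one>\<^bsub>M\<^esub> = f"
  proof
    fix m
    have "(f \<otimes>\<^bsub>monoid_algebra M\<^esub> basis_elem \<one>\<^bsub>M\<^esub>) m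
        = (\<Sum>x\<in>{x. f x \<noteq> 0}. f x * (if x \<otimes>\<^bsub>M\<^esub> \<one>\<^bsub>M\<^esub> = m then 1 else 0))"
      using f basis by (subst monoid_algebra_mult_apply[of "{x. f x \<noteq> 0}" _ "{\<one>\<^bsub>M\<^esub>}"])
        (auto simp: basis_elem_def)
    also have "\<dots> = (\<Sum>x\<in>{x. f x \<noteq> 0}. f x * (if x = m then 1 else 0))"
      using f by (intro sum.cong) auto
    finally show "(f \<otimes>\<^bsub>monoid_algebra M\<^esub> basis_elem \<one>\<^bsub>M\<^esub>) m = f m" using delta by simp
  qed
qed

lemma monoid_algebra_linear:
  assumes f: "f \<in> carrier (monoid_algebra M)" and g: "g \<in> carrier (monoid_algebra M)"
    and h: "h \<in> carrier (monoid_algebra M)"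
  shows "(\<lambda>m. f m + g m) \<otimes>\<^bsub>monoid_algebra M\<^esub> h =
      (\<lambda>m. (f \<otimes>\<^bsub>monoid_algebra M\<^esub> h) m + (g \<otimes>\<^bsub>monoid_algebra M\<^esub> h) m)"
    and "h \<otimes>\<^bsub>monoid_algebra M\<^esub> (\<lambda>m. f m + g m) =
      (\<lambda>m. (h \<otimes>\<^bsub>monoid_algebra M\<^esub> f) m + (h \<otimes>\<^bsub>monoid_algebra M\<^esub> g) m)"
    and "(\<lambda>m. c * f m) \<otimes>\<^bsub>monoid_algebra M\<^esub> h = (\<lambda>m. c * (f \<otimes>\<^bsub>monoid_algebra M\<^esub> h) m)"
    and "h \<otimes>\<^bsub>monoid_algebra M\<^esub> (\<lambda>m. c * f m) = (\<lambda>m. c * (h \<otimes>\<^bsub>monoid_algebra M\<^esub> f) m)"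
proof -
  define X where "X = {x. f x \<noteq> 0} \<union> {x. g x \<noteq> 0}"
  define Y where "Y = {x. h x \<noteq> 0}"
  have fin: "finite X" "finite Y" using assms by (auto simp: X_def Y_def)
  have left: "(k \<otimes>\<^bsub>monoid_algebra M\<^esub> h) m =
      (\<Sum>x\<in>X. \<Sum>y\<in>Y. k x * h y * (if x \<otimes>\<^bsub>M\<^esub> y = m then 1 else 0))"
    if "{x. k x \<noteq> 0} \<subseteq> X" for k m
    using that fin by (intro monoid_algebra_mult_apply) (auto simp: Y_def)
  have right: "(h \<otimes>\<^bsub>monoid_algebra M\<^esub> k) m =
      (\<Sum>y\<in>Y. \<Sum>x\<in>X. h y * k x * (if y \<otimes>\<^bsub>M\<^esub> x = m then 1 else 0))"
    if "{x. k x \<noteq> 0} \<subseteq> X" for k m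
    using that fin by (intro monoid_algebra_mult_apply) (auto simp: Y_def)
  have X: "{x. f x \<noteq> 0} \<subseteq> X" "{x. g x \<noteq> 0} \<subseteq> X" "{x. f x + g x \<noteq> 0} \<subseteq> X" "{x. c * f x \<noteq> 0} \<subseteq> X"
    by (auto simp: X_def)
  show "(\<lambda>m. f m + g m) \<otimes>\<^bsub>monoid_algebra M\<^esub> h =
      (\<lambda>m. (f \<otimes>\<^bsub>monoid_algebra M\<^esub> h) m + (g \<otimes>\<^bsub>monoid_algebra M\<^esub> h) m)"
    by (rule ext) (simp only: X left distrib_right distrib_left sum.distrib)
  show "h \<otimes>\<^bsub>monoid_algebra M\<^esub> (\<lambda>m. f m + g m) =
      (\<lambda>m. (h \<otimes>\<^bsub>monoid_algebra M\<^esub> f) m + (h \<otimes>\<^bsub>monoid_algebra M\<^esub> g) m)"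
    by (rule ext) (simp only: X right distrib_right distrib_left sum.distrib)
  show "(\<lambda>m. c * f m) \<otimes>\<^bsub>monoid_algebra M\<^esub> h = (\<lambda>m. c * (f \<otimes>\<^bsub>monoid_algebra M\<^esub> h) m)"
    by (rule ext) (simp only: X left sum_distrib_left mult.assoc)
  show "h \<otimes>\<^bsub>monoid_algebra M\<^esub> (\<lambda>m. c * f m) = (\<lambda>m. c * (h \<otimes>\<^bsub>monoid_algebra M\<^esub> f) m)"
    by (rule ext) (simp only: X right sum_distrib_left mult_ac)
qed

lemma monoid_algebra_add_closed:
  assumes "f \<in> carrier (monoid_algebra M)" "g \<in> carrier (monoid_algebra M)"
  shows "(\<lambda>m. f m + g m) \<in> carrier (monoid_algebra M)"
proof -
  have "{m. f m + g m \<noteq> 0} \<subseteq> {m. f m \<noteq> 0} \<union> {m. g m \<noteq> 0}" by auto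
  with assms show ?thesis by (auto intro: finite_subset)
qed

lemma monoid_algebra_smult_closed:
  assumes "f \<in> carrier (monoid_algebra M)"
  shows "(\<lambda>m. c * f m) \<in> carrier (monoid_algebra M)"
  using assms by (auto elim: rev_finite_subset)

theorem monoid_algebra_complex_algebra:
  assumes "monoid M"
  shows "complex_algebra (monoid_algebra M)"
proof (rule complex_algebraI)
  interpret monoid M by fact
  let ?R = "monoid_algebra M"
  show "ring ?R"
  proof (rule ringI)
    show "abelian_group ?R"
    proof (rule abelian_groupI)
      fix f assume f: "f \<in> carrier ?R"
      show "\<exists>g\<in>carrier ?R. g \<oplus>\<^bsub>?R\<^esub> f = \<zero>\<^bsub>?R\<^esub>"
        using f monoid_algebra_smult_closed[OF f, of "-1"]
        by (intro bexI[of _ "\<lambda>m. -1 * f m"]) simp_all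
      fix g assume g: "g \<in> carrier ?R"
      show "f \<oplus>\<^bsub>?R\<^esub> g \<in> carrier ?R"
        using monoid_algebra_add_closed[OF f g] unfolding monoid_algebra_simps(4) .
    qed (simp_all add: add_ac)
    show "monoid ?R"
    proof (rule monoidI)
      show "\<one>\<^bsub>?R\<^esub> \<in> carrier ?R" unfolding monoid_algebra_simps(3) by (rule basis_elem_closed) simp
    qed (simp_all only: monoid_algebra_mult_closed monoid_algebra_mult_assoc
          monoid_algebra_mult_one monoid_algebra_simps(3) assms)
  qed (simp_all only: monoid_algebra_linear monoid_algebra_simps(4))
qed (simp_all only: monoid_algebra_linear monoid_algebra_smult_closed monoid_algebra_simps(4,5)
      distrib_left distrib_right mult.assoc mult_1_left)

lemma monoid_algebra_induct [consumes 1, case_names zero add]: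
  assumes "f \<in> carrier (monoid_algebra M)"
    and "P \<zero>\<^bsub>monoid_algebra M\<^esub>"
    and step: "\<And>c x f. x \<in> carrier M \<Longrightarrow> f \<in> carrier (monoid_algebra M) \<Longrightarrow> P f \<Longrightarrow>
      P (c \<odot>\<^bsub>monoid_algebra M\<^esub> basis_elem x \<oplus>\<^bsub>monoid_algebra M\<^esub> f)"
  shows "P f"
proof -
  have "finite S \<Longrightarrow> S \<subseteq> carrier M \<Longrightarrow> {m. f m \<noteq> 0} \<subseteq> S \<Longrightarrow> P f" for S f
  proof (induction S arbitrary: f rule: finite_induct)
    case empty
    then have "f = \<zero>\<^bsub>monoid_algebra M\<^esub>" by auto
    then show ?case using assms(2) by simp
  next
    case (insert x S)
    let ?g = "f(x := 0)"
    have sub: "{m. ?g m \<noteq> 0} \<subseteq> S" using insert.prems by auto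
    with insert have "P ?g" by auto
    moreover have "?g \<in> carrier (monoid_algebra M)"
      using sub insert finite_subset[OF sub insert.hyps(1)]
      unfolding monoid_algebra_simps(1) by blast
    moreover have "f = f x \<odot>\<^bsub>monoid_algebra M\<^esub> basis_elem x \<oplus>\<^bsub>monoid_algebra M\<^esub> ?g"
      by (auto simp: basis_elem_def)
    ultimately show ?case using step[of x ?g "f x"] insert.prems(1) by (metis insert_subset)
  qed
  from this[of "{m. f m \<noteq> 0}" f] assms(1) show ?thesis by simp
qed

lemma monoid_algebra_memI:
  assumes "finite S" "S \<subseteq> carrier M" "\<And>m. m \<notin> S \<Longrightarrow> f m = 0"
  shows "f \<in> carrier (monoid_algebra M)"
proof -
  have "{m. f m \<noteq> 0} \<subseteq> S" using assms(3) by auto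
  then show ?thesis using assms(1,2) by (auto intro: finite_subset)
qed

lemma basis_difference_closed:
  assumes "x \<in> carrier M" "y \<in> carrier M"
  shows "(\<lambda>m. basis_elem x m - c * basis_elem y m) \<in> carrier (monoid_algebra M)" (is ?scaled)
    and "(\<lambda>m. basis_elem x m - basis_elem y m) \<in> carrier (monoid_algebra M)" (is ?plain)
    and "z \<in> carrier M \<Longrightarrow>
      (\<lambda>m. basis_elem x m - basis_elem y m - basis_elem z m) \<in> carrier (monoid_algebra M)"
proof -
  show ?scaled ?plain
    by (rule monoid_algebra_memI[of "{x, y}"]; use assms in \<open>simp add: basis_elem_def\<close>)+
  show "(\<lambda>m. basis_elem x m - basis_elem y m - basis_elem z m) \<in> carrier (monoid_algebra M)"
    if "z \<in> carrier M"
    by (rule monoid_algebra_memI[of "{x, y, z}"]; use assms that in \<open>simp add: basis_elem_def\<close>)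
qed

lemma quotient_algebra_simps [simp]:
  "carrier (quotient_algebra A J) = carrier (A Quot J)"
  "mult (quotient_algebra A J) = mult (A Quot J)"
  "one (quotient_algebra A J) = one (A Quot J)"
  "zero (quotient_algebra A J) = zero (A Quot J)"
  "add (quotient_algebra A J) = add (A Quot J)"
  by (simp_all add: quotient_algebra_def)

lemma quotient_carrierE:
  assumes "X \<in> carrier (A Quot J)"
  obtains x where "x \<in> carrier A" "X = J +>\<^bsub>A\<^esub> x"
  using assms by (auto simp: FactRing_simps)

text \<open>
  Because of the unit, ideals of the ring are stable under scalars: \<open>c \<odot> x = (c \<odot> \<one>) \<otimes> x\<close>.
\<close>

lemma (in complex_algebra) smult_ideal:
  assumes "ideal J A" "x \<in> J"
  shows "c \<odot> x \<in> J"
proof -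
  interpret J: ideal J A by fact
  have "x \<in> carrier A" using assms(2) by (rule J.a_Hcarr)
  then have "c \<odot> x = (c \<odot> \<one>) \<otimes> x"
    using smult_mult_left[of \<one> x c] by simp
  moreover have "c \<odot> \<one> \<in> carrier A" by simp
  ultimately show ?thesis using J.I_l_closed[OF assms(2), of "c \<odot> \<one>"] by simp
qed

lemma quotient_smult:
  assumes "complex_algebra A" "ideal J A" "x \<in> carrier A"
  shows "c \<odot>\<^bsub>quotient_algebra A J\<^esub> (J +>\<^bsub>A\<^esub> x) = J +>\<^bsub>A\<^esub> (c \<odot>\<^bsub>A\<^esub> x)"
proof -
  interpret complex_algebra A by fact
  interpret J: ideal J A by fact
  have indep: "J +>\<^bsub>A\<^esub> (c \<odot>\<^bsub>A\<^esub> y) = J +>\<^bsub>A\<^esub> (c \<odot>\<^bsub>A\<^esub> x)" if y: "y \<in> J +>\<^bsub>A\<^esub> x" for y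
  proof -
    obtain j where j: "j \<in> J" "y = j \<oplus>\<^bsub>A\<^esub> x"
      using y by (auto simp: a_r_coset_def r_coset_def)
    have "c \<odot>\<^bsub>A\<^esub> y = c \<odot>\<^bsub>A\<^esub> j \<oplus>\<^bsub>A\<^esub> c \<odot>\<^bsub>A\<^esub> x"
      unfolding j(2) using J.a_Hcarr[OF j(1)] assms(3) by (simp add: smult_r_distr)
    then have "c \<odot>\<^bsub>A\<^esub> y \<in> J +>\<^bsub>A\<^esub> (c \<odot>\<^bsub>A\<^esub> x)"
      using smult_ideal[OF assms(2) j(1), of c] by (auto simp: a_r_coset_def r_coset_def)
    from J.a_repr_independence'[OF this] show ?thesis using assms(3) by simp
  qed
  have "x \<in> J +>\<^bsub>A\<^esub> x" using assms(3) by (rule J.a_rcos_self)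
  from UN_constant_eq[OF this, of "\<lambda>y. J +>\<^bsub>A\<^esub> (c \<odot>\<^bsub>A\<^esub> y)"] indep
  show ?thesis by (simp add: quotient_algebra_def)
qed

lemma quotient_algebra_complex_algebra:
  assumes "complex_algebra A" "ideal J A"
  shows "complex_algebra (quotient_algebra A J)"
proof -
  interpret complex_algebra A by fact
  interpret J: ideal J A by fact
  interpret Q: ring "A Quot J" by (rule J.quotient_is_ring)
  note hom = J.rcos_ring_hom
  show ?thesis
  proof (rule complex_algebraI)
    show "ring (quotient_algebra A J)"
    proof (rule ringI)
      show "abelian_group (quotient_algebra A J)"
      proof (rule abelian_groupI)
        fix x assume "x \<in> carrier (quotient_algebra A J)"
        then show "\<exists>y\<in>carrier (quotient_algebra A J).
            y \<oplus>\<^bsub>quotient_algebra A J\<^esub> x = \<zero>\<^bsub>quotient_algebra A J\<^esub>"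
          using Q.l_neg[of x] by (intro bexI[of _ "\<ominus>\<^bsub>A Quot J\<^esub> x"]) simp_all
      qed (simp_all add: Q.a_ac)
      show "monoid (quotient_algebra A J)"
        by (rule monoidI) (simp_all add: Q.m_assoc)
    qed (simp_all add: Q.l_distr Q.r_distr)
  qed (use smult_l_distr smult_r_distr smult_assoc1 smult_one smult_mult_left smult_mult_right in
      \<open>auto elim!: quotient_carrierE simp: ring_hom_add[OF hom, symmetric]
         ring_hom_mult[OF hom, symmetric] quotient_smult[OF assms] ring_hom_closed[OF hom]\<close>)
qed

lemma quotient_map_algebra_hom:
  assumes "complex_algebra A" "ideal J A"
  shows "(\<lambda>x. J +>\<^bsub>A\<^esub> x) \<in> algebra_hom A (quotient_algebra A J)"
  using ideal.rcos_ring_hom[OF assms(2)] quotient_smult[OF assms]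
  by (auto simp: algebra_hom_def ring_hom_def)

text \<open>
  Defining relations are differences of the two sides of an equation; their membership in the ideal
  becomes the equation between the cosets.
\<close>

lemma quotient_relation:
  assumes "ideal J A" "y \<in> carrier A" "r \<in> J" "x = r \<oplus>\<^bsub>A\<^esub> y"
  shows "J +>\<^bsub>A\<^esub> x = J +>\<^bsub>A\<^esub> y"
proof -
  interpret J: ideal J A by fact
  have "x \<in> J +>\<^bsub>A\<^esub> y" using assms by (auto simp: a_r_coset_def r_coset_def)
  from J.a_repr_independence'[OF this] show ?thesis using assms(2) by simp
qed

section \<open>Free products and centred words\<close>

lemma word_monoid_monoid: "monoid (word_monoid I A)"
  by unfold_locales (auto simp: word_monoid_def)

locale algebra_family =
  fixes I :: "'i set" and A :: "'i \<Rightarrow> 'a calg"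
  assumes algebras: "\<And>i. i \<in> I \<Longrightarrow> complex_algebra (A i)"
begin

abbreviation "W \<equiv> monoid_algebra (word_monoid I A)"
abbreviation "J \<equiv> free_ideal I A"
abbreviation "F \<equiv> free_product I A"

lemma word_algebra: "complex_algebra W"
  by (rule monoid_algebra_complex_algebra[OF word_monoid_monoid])

lemma word_basis_closed:
  assumes "w \<in> lists (SIGMA i:I. carrier (A i))"
  shows "basis_elem w \<in> carrier W"
  using assms by (intro basis_elem_closed) (simp add: word_monoid_def)

lemma factor_closed:
  assumes "i \<in> I"
  shows "\<And>x y. x \<in> carrier (A i) \<Longrightarrow> y \<in> carrier (A i) \<Longrightarrow> x \<oplus>\<^bsub>A i\<^esub> y \<in> carrier (A i)"
    and "\<And>x y. x \<in> carrier (A i) \<Longrightarrow> y \<in> carrier (A i) \<Longrightarrow> x \<otimes>\<^bsub>A i\<^esub> y \<in> carrier (A i)"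
    and "\<And>c x. x \<in> carrier (A i) \<Longrightarrow> c \<odot>\<^bsub>A i\<^esub> x \<in> carrier (A i)"
    and "\<one>\<^bsub>A i\<^esub> \<in> carrier (A i)"
proof -
  interpret complex_algebra "A i" using assms by (rule algebras)
  show "\<And>x y. x \<in> carrier (A i) \<Longrightarrow> y \<in> carrier (A i) \<Longrightarrow> x \<oplus>\<^bsub>A i\<^esub> y \<in> carrier (A i)"
    and "\<And>x y. x \<in> carrier (A i) \<Longrightarrow> y \<in> carrier (A i) \<Longrightarrow> x \<otimes>\<^bsub>A i\<^esub> y \<in> carrier (A i)"
    and "\<And>c x. x \<in> carrier (A i) \<Longrightarrow> c \<odot>\<^bsub>A i\<^esub> x \<in> carrier (A i)"
    and "\<one>\<^bsub>A i\<^esub> \<in> carrier (A i)"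
    by simp_all
qed

lemma free_relations_closed: "free_relations I A \<subseteq> carrier W"
  unfolding free_relations_def
  by (intro Un_least subsetI; elim CollectE exE conjE; simp only:;
      intro basis_difference_closed; simp add: word_monoid_def factor_closed)

lemma free_ideal_ideal: "ideal J W"
  and free_relations_in_ideal: "free_relations I A \<subseteq> J"
proof -
  interpret complex_algebra W by (rule word_algebra)
  show "ideal J W" "free_relations I A \<subseteq> J"
    unfolding free_ideal_def
    by (rule genideal_ideal[OF free_relations_closed] genideal_self[OF free_relations_closed])+
qed

lemma free_product_algebra: "complex_algebra F"
  unfolding free_product_def
  by (rule quotient_algebra_complex_algebra[OF word_algebra free_ideal_ideal])

lemma free_product_map: "(\<lambda>f. J +>\<^bsub>W\<^esub> f) \<in> algebra_hom W F"
  unfolding free_product_def by (rule quotient_map_algebra_hom[OF word_algebra free_ideal_ideal])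

text \<open>
  Each of the four families of relations is one of the properties of a unital homomorphism of algebras.
\<close>

lemma free_incl_algebra_hom:
  assumes i: "i \<in> I"
  shows "free_incl I A i \<in> algebra_hom (A i) F"
proof -
  note hom = algebra_homD[OF free_product_map]
  note rel = quotient_relation[OF free_ideal_ideal _ subsetD[OF free_relations_in_ideal]]
  interpret W: complex_algebra W by (rule word_algebra)
  have b: "basis_elem [(i, x)] \<in> carrier W" if "x \<in> carrier (A i)" for x
    using that i by (intro word_basis_closed) auto
  have "free_incl I A i (x \<oplus>\<^bsub>A i\<^esub> y) = free_incl I A i x \<oplus>\<^bsub>F\<^esub> free_incl I A i y"
    if "x \<in> carrier (A i)" "y \<in> carrier (A i)" for x y
    unfolding free_incl_def hom(3)[OF b b, OF that, symmetric]
    by (rule rel[where r = "\<lambda>w. basis_elem [(i, x \<oplus>\<^bsub>A i\<^esub> y)] w - basis_elem [(i, x)] w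
          - basis_elem [(i, y)] w"])
      (use that i b in \<open>auto simp: free_relations_def simp del: monoid_algebra_simps(1,4)\<close>, simp)
  moreover have "free_incl I A i (c \<odot>\<^bsub>A i\<^esub> x) = c \<odot>\<^bsub>F\<^esub> free_incl I A i x"
    if "x \<in> carrier (A i)" for c x
    unfolding free_incl_def hom(5)[OF b, OF that, symmetric]
    by (rule rel[where r = "\<lambda>w. basis_elem [(i, c \<odot>\<^bsub>A i\<^esub> x)] w - c * basis_elem [(i, x)] w"])
      (use that i b in \<open>auto simp: free_relations_def simp del: monoid_algebra_simps(1,5)\<close>, simp)
  moreover have "free_incl I A i (x \<otimes>\<^bsub>A i\<^esub> y) = free_incl I A i x \<otimes>\<^bsub>F\<^esub> free_incl I A i y"
    if "x \<in> carrier (A i)" "y \<in> carrier (A i)" for x y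
  proof -
    have m: "basis_elem [(i, x)] \<otimes>\<^bsub>W\<^esub> basis_elem [(i, y)] = basis_elem [(i, x), (i, y)]"
      by (simp add: basis_elem_mult) (simp add: word_monoid_def)
    show ?thesis
      unfolding free_incl_def hom(2)[OF b b, OF that, symmetric] m
      by (rule rel[where r = "\<lambda>w. basis_elem [(i, x \<otimes>\<^bsub>A i\<^esub> y)] w - basis_elem [(i, x), (i, y)] w"])
        (use that i in \<open>auto simp: free_relations_def intro!: word_basis_closed
           simp del: monoid_algebra_simps(1)\<close>)
  qed
  moreover have "free_incl I A i \<one>\<^bsub>A i\<^esub> = \<one>\<^bsub>F\<^esub>"
  proof -
    have o: "\<one>\<^bsub>W\<^esub> = basis_elem []" by (simp add: word_monoid_def)
    show ?thesis
      unfolding free_incl_def hom(4)[symmetric] o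
      by (rule rel[where r = "\<lambda>w. basis_elem [(i, \<one>\<^bsub>A i\<^esub>)] w - basis_elem [] w"])
        (use i in \<open>auto simp: free_relations_def intro!: word_basis_closed
           simp del: monoid_algebra_simps(1)\<close>)
  qed
  moreover have "free_incl I A i x \<in> carrier F" if "x \<in> carrier (A i)" for x
    unfolding free_incl_def by (rule hom(1)[OF b[OF that]])
  ultimately show ?thesis
    by (simp add: algebra_hom_def ring_hom_def)
qed

text \<open>
  The free product is generated by the factors: as a vector space it is spanned by the words, and each
  word is built from the empty word by prepending letters.
\<close>

lemma free_product_generated:
  assumes H: "submodule H complex_ring F" and one: "\<one>\<^bsub>F\<^esub> \<in> H"
    and step: "\<And>i a x. i \<in> I \<Longrightarrow> a \<in> carrier (A i) \<Longrightarrow> x \<in> H \<Longrightarrow> free_incl I A i a \<otimes>\<^bsub>F\<^esub> x \<in> H"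
  shows "carrier F \<subseteq> H"
proof
  interpret submodule H complex_ring F by (rule H)
  interpret W: complex_algebra W by (rule word_algebra)
  note hom = algebra_homD[OF free_product_map]
  have word: "J +>\<^bsub>W\<^esub> basis_elem w \<in> H" if "w \<in> lists (SIGMA i:I. carrier (A i))" for w
    using that
  proof (induction w rule: lists.induct)
    case Nil
    have "\<one>\<^bsub>W\<^esub> = basis_elem []" by (simp add: word_monoid_def)
    then show ?case using one hom(4) by metis
  next
    case (Cons p w)
    obtain i a where p: "p = (i, a)" "i \<in> I" "a \<in> carrier (A i)" using Cons.hyps by auto
    have "basis_elem (p # w) = basis_elem [p] \<otimes>\<^bsub>W\<^esub> basis_elem w"
      by (simp add: basis_elem_mult) (simp add: word_monoid_def)
    then have "J +>\<^bsub>W\<^esub> basis_elem (p # w) = free_incl I A i a \<otimes>\<^bsub>F\<^esub> (J +>\<^bsub>W\<^esub> basis_elem w)"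
      unfolding free_incl_def p(1)[symmetric]
      using Cons.hyps by (simp only:) (intro hom(2) word_basis_closed; simp)
    then show ?case using step p Cons.IH by simp
  qed
  fix x assume "x \<in> carrier F"
  then obtain f where f: "f \<in> carrier W" "x = J +>\<^bsub>W\<^esub> f"
    by (auto simp: free_product_def simp del: monoid_algebra_simps elim!: quotient_carrierE)
  from f(1) have "J +>\<^bsub>W\<^esub> f \<in> H"
  proof (induction f rule: monoid_algebra_induct)
    case zero
    have "\<zero>\<^bsub>W\<^esub> = 0 \<odot>\<^bsub>W\<^esub> \<one>\<^bsub>W\<^esub>" using W.smult_l_null[of "\<one>\<^bsub>W\<^esub>"] W.one_closed by simp
    then have "J +>\<^bsub>W\<^esub> \<zero>\<^bsub>W\<^esub> = 0 \<odot>\<^bsub>F\<^esub> \<one>\<^bsub>F\<^esub>"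
      using hom(5)[OF W.one_closed] hom(4) by metis
    then show ?case using smult_closed[of 0] one by simp
  next
    case (add c w f)
    have w: "w \<in> lists (SIGMA i:I. carrier (A i))" using add.hyps(1) by (simp add: word_monoid_def)
    have "c \<odot>\<^bsub>W\<^esub> basis_elem w \<in> carrier W"
      using word_basis_closed[OF w] by (intro W.smult_closed) simp_all
    then have "J +>\<^bsub>W\<^esub> (c \<odot>\<^bsub>W\<^esub> basis_elem w \<oplus>\<^bsub>W\<^esub> f)
      = c \<odot>\<^bsub>F\<^esub> (J +>\<^bsub>W\<^esub> basis_elem w) \<oplus>\<^bsub>F\<^esub> (J +>\<^bsub>W\<^esub> f)"
      using hom(3)[OF _ add.hyps(2)] hom(5)[OF word_basis_closed[OF w]] by simp
    then show ?case using smult_closed[of c] word[OF w] add.IH m_closed by simp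
  qed
  then show "x \<in> H" using f(2) by simp
qed

end

text \<open>
  This reduces the stability of a span under left multiplication to a check on the spanning vectors.
\<close>

lemma (in complex_algebra) left_mult_preimage_submodule:
  assumes H: "submodule H complex_ring A" and a: "a \<in> carrier A"
  shows "submodule {x \<in> carrier A. a \<otimes> x \<in> H} complex_ring A"
proof -
  interpret H: submodule H complex_ring A by (rule H)
  have "\<ominus> x \<in> H" if "x \<in> H" for x
    using H.m_inv_closed[OF that] by (simp add: a_inv_def)
  then show ?thesis
    using a H.one_closed H.m_closed H.smult_closed
    by (intro submoduleI) (auto simp: r_distr r_minus smult_mult_right)
qed

lemma centring:
  fixes A (structure)
  assumes "complex_algebra A" and \<tau>: "linear_functional A \<tau>" "\<tau> \<one> = 1" and a: "a \<in> carrier A"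
  obtains a0 where "a0 \<in> carrier A" "\<tau> a0 = 0" "a = \<tau> a \<odot> \<one> \<oplus> a0"
proof
  interpret complex_algebra A by fact
  let ?a0 = "(- \<tau> a) \<odot> \<one> \<oplus> a"
  show "?a0 \<in> carrier A" using a by simp
  show "\<tau> ?a0 = 0" using \<tau> a by (simp add: linear_functional_def)
  have "\<tau> a \<odot> \<one> \<oplus> (- \<tau> a) \<odot> \<one> = \<zero>"
    using smult_l_distr[of "\<tau> a" "- \<tau> a" \<one>] smult_l_null[of \<one>] by simp
  then have "(\<tau> a \<odot> \<one> \<oplus> (- \<tau> a) \<odot> \<one>) \<oplus> a = a" using a by simp
  then show "a = \<tau> a \<odot> \<one> \<oplus> ?a0" using a by (simp add: a_assoc)
qed

context algebra_family
begin

definition word_product :: "('i \<times> 'a) list \<Rightarrow> ('i, 'a) free_elem" where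
  "word_product w = list_product F (map (\<lambda>(i, a). free_incl I A i a) w)"

lemma word_product_Cons: "word_product ((i, a) # w) = free_incl I A i a \<otimes>\<^bsub>F\<^esub> word_product w"
  by (simp add: word_product_def)

lemma word_factors_closed:
  assumes "set w \<subseteq> (SIGMA i:I. carrier (A i))"
  shows "set (map (\<lambda>(i, a). free_incl I A i a) w) \<subseteq> carrier F"
  using assms algebra_homD(1)[OF free_incl_algebra_hom] by fastforce

lemma word_product_closed:
  assumes "set w \<subseteq> (SIGMA i:I. carrier (A i))"
  shows "word_product w \<in> carrier F"
proof -
  interpret complex_algebra F by (rule free_product_algebra)
  show ?thesis
    unfolding word_product_def by (rule list_product_closed[OF word_factors_closed[OF assms]])
qed

text \<open>
  The span of the centred words is stable under left multiplication by the factors, and it contains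
  \<open>1\<close> as the empty word, so it is everything.  Let \<open>a\<close> be in the factor with index \<open>i\<close>.  If \<open>v\<close> does not
  start with index \<open>i\<close>, split \<open>a\<close> into \<open>\<tau> i a\<close> times \<open>1\<close> and a centred element \<open>a0\<close>: the first part gives
  a multiple of \<open>v\<close> and the second the centred word that starts with \<open>a0\<close>.  A word that starts with
  a letter \<open>b\<close> of index \<open>i\<close> is brought to this situation by replacing \<open>a\<close> with \<open>a \<otimes> b\<close>; its tail
  does not start with index \<open>i\<close> because neighbouring indices differ.
\<close>

theorem centred_words_span:
  assumes \<tau>: "\<And>i. i \<in> I \<Longrightarrow> linear_functional (A i) (\<tau> i)" "\<And>i. i \<in> I \<Longrightarrow> \<tau> i \<one>\<^bsub>A i\<^esub> = 1"
  shows "carrier F \<subseteq>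
    linear_combinations F word_product {w. centred_word I (\<lambda>i. carrier (A i)) \<tau> w}"
    (is "_ \<subseteq> linear_combinations F _ ?C")
proof -
  interpret F: complex_algebra F by (rule free_product_algebra)
  let ?H = "linear_combinations F word_product ?C"
  have closed: "word_product w \<in> carrier F" if "w \<in> ?C" for w
    using that by (intro word_product_closed) (auto simp: centred_word_def)
  have H: "submodule ?H complex_ring F"
    using closed by (rule F.linear_combinations_submodule)
  interpret H: submodule ?H complex_ring F by (rule H)
  have gen: "word_product w \<in> ?H" if "w \<in> ?C" for w
    using that closed by (intro F.linear_combinations_generator)
  have prepend: "free_incl I A i a \<otimes>\<^bsub>F\<^esub> word_product v \<in> ?H"
    if i: "i \<in> I" and a: "a \<in> carrier (A i)" and v: "v \<in> ?C" "v = [] \<or> fst (hd v) \<noteq> i" for i a v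
  proof -
    note hom = algebra_homD[OF free_incl_algebra_hom[OF i]]
    obtain a0 where a0: "a0 \<in> carrier (A i)" "\<tau> i a0 = 0"
        "a = \<tau> i a \<odot>\<^bsub>A i\<^esub> \<one>\<^bsub>A i\<^esub> \<oplus>\<^bsub>A i\<^esub> a0"
      using centring[OF algebras[OF i] \<tau>(1)[OF i] \<tau>(2)[OF i] a] .
    have "free_incl I A i a = \<tau> i a \<odot>\<^bsub>F\<^esub> \<one>\<^bsub>F\<^esub> \<oplus>\<^bsub>F\<^esub> free_incl I A i a0"
      by (subst a0(3)) (simp add: hom a0(1) factor_closed(3,4)[OF i])
    then have "free_incl I A i a \<otimes>\<^bsub>F\<^esub> word_product v
       = \<tau> i a \<odot>\<^bsub>F\<^esub> word_product v \<oplus>\<^bsub>F\<^esub> word_product ((i, a0) # v)"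
      using closed[OF v(1)] hom(1)[OF a0(1)]
      by (simp add: F.l_distr F.smult_mult_left word_product_Cons)
    moreover have "(i, a0) # v \<in> ?C"
      using i a0(1,2) v by (auto simp: centred_word_def successively_Cons)
    ultimately show ?thesis
      using gen v(1) H.smult_closed[of "\<tau> i a"] H.m_closed by simp
  qed
  have "free_incl I A i a \<otimes>\<^bsub>F\<^esub> word_product w \<in> ?H"
    if i: "i \<in> I" and a: "a \<in> carrier (A i)" and w: "w \<in> ?C" for i a w
  proof (cases "w = [] \<or> fst (hd w) \<noteq> i")
    case True
    then show ?thesis using prepend i a w by blast
  next
    case False
    then obtain b v where wv: "w = (i, b) # v" by (cases w) auto
    note hom = algebra_homD[OF free_incl_algebra_hom[OF i]]
    have b: "b \<in> carrier (A i)" and v: "v \<in> ?C" "v = [] \<or> fst (hd v) \<noteq> i"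
      using w unfolding wv by (auto simp: centred_word_def successively_Cons)
    have "free_incl I A i a \<otimes>\<^bsub>F\<^esub> word_product w
        = free_incl I A i (a \<otimes>\<^bsub>A i\<^esub> b) \<otimes>\<^bsub>F\<^esub> word_product v"
      using a b closed[OF v(1)] hom(1)
      by (simp add: wv word_product_Cons hom(2) F.m_assoc)
    then show ?thesis using prepend[OF i _ v] factor_closed(2)[OF i a b] by simp
  qed
  then have step: "free_incl I A i a \<otimes>\<^bsub>F\<^esub> x \<in> ?H"
    if "i \<in> I" "a \<in> carrier (A i)" "x \<in> ?H" for i a x
  proof -
    have fa: "free_incl I A i a \<in> carrier F"
      using algebra_homD(1)[OF free_incl_algebra_hom] that by blast
    have "?H \<subseteq> {x \<in> carrier F. free_incl I A i a \<otimes>\<^bsub>F\<^esub> x \<in> ?H}"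
      using F.left_mult_preimage_submodule[OF H fa] that(1,2) closed
        \<open>\<And>w a i. i \<in> I \<Longrightarrow> a \<in> carrier (A i) \<Longrightarrow> w \<in> ?C \<Longrightarrow> free_incl I A i a \<otimes>\<^bsub>F\<^esub> word_product w \<in> ?H\<close>
      by (intro F.linear_combinations_minimal) auto
    then show ?thesis using that(3) by blast
  qed
  have "[] \<in> ?C" by (simp add: centred_word_def)
  from gen[OF this] have "\<one>\<^bsub>F\<^esub> \<in> ?H" by (simp add: word_product_def)
  then show ?thesis using free_product_generated[OF H] step by blast
qed

end

section \<open>Tensor products\<close>

lemma tensor_relations_closed:
  assumes "complex_algebra B" "complex_algebra C"
  shows "tensor_relations B C \<subseteq> carrier (monoid_algebra (B \<times>\<times> C))"
proof -
  interpret B: complex_algebra B by fact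
  interpret C: complex_algebra C by fact
  show ?thesis
    unfolding tensor_relations_def
    by (intro Un_least subsetI; elim CollectE exE conjE; simp only:;
        intro basis_difference_closed; simp)
qed

lemma
  assumes "complex_algebra B" "complex_algebra C"
  shows tensor_monoid_algebra: "complex_algebra (monoid_algebra (B \<times>\<times> C))"
    and tensor_ideal_ideal: "ideal (tensor_ideal B C) (monoid_algebra (B \<times>\<times> C))"
    and tensor_relations_in_ideal: "tensor_relations B C \<subseteq> tensor_ideal B C"
proof -
  interpret B: complex_algebra B by fact
  interpret C: complex_algebra C by fact
  show *: "complex_algebra (monoid_algebra (B \<times>\<times> C))"
    by (intro monoid_algebra_complex_algebra DirProd_monoid B.monoid_axioms C.monoid_axioms)
  interpret R: complex_algebra "monoid_algebra (B \<times>\<times> C)" by (rule *)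
  show "ideal (tensor_ideal B C) (monoid_algebra (B \<times>\<times> C))"
    "tensor_relations B C \<subseteq> tensor_ideal B C"
    unfolding tensor_ideal_def
    by (rule R.genideal_ideal R.genideal_self, rule tensor_relations_closed[OF assms])+
qed

lemma tensor_algebra_algebra:
  assumes "complex_algebra B" "complex_algebra C"
  shows "complex_algebra (tensor_algebra B C)"
  unfolding tensor_algebra_def
  by (intro quotient_algebra_complex_algebra tensor_monoid_algebra tensor_ideal_ideal assms)

text \<open>
  Multiplicativity holds already for basis elements of the monoid algebra; the bilinearity relations
  are what makes the map linear.
\<close>

lemma pure_tensor_right_algebra_hom:
  assumes BC: "complex_algebra B" "complex_algebra C"
  shows "pure_tensor B C \<one>\<^bsub>B\<^esub> \<in> algebra_hom C (tensor_algebra B C)"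
proof -
  interpret B: complex_algebra B by fact
  interpret C: complex_algebra C by fact
  let ?R = "monoid_algebra (B \<times>\<times> C)"
  let ?e = "\<lambda>c. basis_elem (\<one>\<^bsub>B\<^esub>, c)"
  have "(\<lambda>f. tensor_ideal B C +>\<^bsub>?R\<^esub> f) \<in> algebra_hom ?R (tensor_algebra B C)"
    unfolding tensor_algebra_def
    by (intro quotient_map_algebra_hom tensor_monoid_algebra tensor_ideal_ideal BC)
  note hom = algebra_homD[OF this]
  note rel = quotient_relation[OF tensor_ideal_ideal[OF BC] _
      subsetD[OF tensor_relations_in_ideal[OF BC]]]
  interpret R: complex_algebra ?R by (rule tensor_monoid_algebra[OF BC])
  have b: "?e c \<in> carrier ?R" if "c \<in> carrier C" for c
    using that by (intro basis_elem_closed) simp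
  have "pure_tensor B C \<one>\<^bsub>B\<^esub> (x \<oplus>\<^bsub>C\<^esub> y) =
      pure_tensor B C \<one>\<^bsub>B\<^esub> x \<oplus>\<^bsub>tensor_algebra B C\<^esub> pure_tensor B C \<one>\<^bsub>B\<^esub> y"
    if "x \<in> carrier C" "y \<in> carrier C" for x y
  proof -
    have "(\<lambda>p. ?e (x \<oplus>\<^bsub>C\<^esub> y) p - ?e x p - ?e y p) \<in> tensor_relations B C"
      unfolding tensor_relations_def using that B.one_closed by blast
    then show ?thesis
      unfolding pure_tensor_def hom(3)[OF b b, OF that, symmetric]
      by (rule rel[rotated]) (use R.a_closed[OF b b, OF that] in simp_all)
  qed
  moreover have "pure_tensor B C \<one>\<^bsub>B\<^esub> (z \<odot>\<^bsub>C\<^esub> x) =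
      z \<odot>\<^bsub>tensor_algebra B C\<^esub> pure_tensor B C \<one>\<^bsub>B\<^esub> x"
    if "x \<in> carrier C" for z x
  proof -
    have "(\<lambda>p. ?e (z \<odot>\<^bsub>C\<^esub> x) p - z * ?e x p) \<in> tensor_relations B C"
      unfolding tensor_relations_def using that B.one_closed by blast
    then show ?thesis
      unfolding pure_tensor_def hom(5)[OF b, OF that, symmetric]
      by (rule rel[rotated]) (use R.smult_closed[OF _ b, OF _ that, of z] in simp_all)
  qed
  moreover have "pure_tensor B C \<one>\<^bsub>B\<^esub> (x \<otimes>\<^bsub>C\<^esub> y) =
      pure_tensor B C \<one>\<^bsub>B\<^esub> x \<otimes>\<^bsub>tensor_algebra B C\<^esub> pure_tensor B C \<one>\<^bsub>B\<^esub> y"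
    if "x \<in> carrier C" "y \<in> carrier C" for x y
    unfolding pure_tensor_def hom(2)[OF b b, OF that, symmetric] by (simp add: basis_elem_mult)
  moreover have "pure_tensor B C \<one>\<^bsub>B\<^esub> \<one>\<^bsub>C\<^esub> = \<one>\<^bsub>tensor_algebra B C\<^esub>"
    unfolding pure_tensor_def hom(4)[symmetric] by simp
  moreover have "pure_tensor B C \<one>\<^bsub>B\<^esub> x \<in> carrier (tensor_algebra B C)" if "x \<in> carrier C" for x
    unfolding pure_tensor_def by (rule hom(1)[OF b[OF that]])
  ultimately show ?thesis
    by (simp add: algebra_hom_def ring_hom_def)
qed

section \<open>Reflection positivity of the bi-free product\<close>

definition letter_kernel ::
    "('i \<Rightarrow> 'a calg) \<Rightarrow> ('i \<Rightarrow> 'a \<Rightarrow> 'a) \<Rightarrow> ('i \<Rightarrow> 'a \<Rightarrow> complex) \<Rightarrow> 'i \<times> 'a \<Rightarrow> 'i \<times> 'a \<Rightarrow> complex" where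
  "letter_kernel A \<theta> \<tau> = (\<lambda>(j, a) (i, b). if j = i then \<tau> i (\<theta> i a \<otimes>\<^bsub>A i\<^esub> b) else 0)"

text \<open>
  The values that the functional of a bi-free product takes on the product of the reflection of
  a centred word and a centred word.
\<close>

definition word_kernel ::
    "('i \<Rightarrow> 'a calg) \<Rightarrow> ('i \<Rightarrow> 'a \<Rightarrow> 'a) \<Rightarrow> ('i \<Rightarrow> 'a \<Rightarrow> complex) \<Rightarrow>
     ('i \<times> 'a) list \<Rightarrow> ('i \<times> 'a) list \<Rightarrow> complex" where
  "word_kernel A \<theta> \<tau> v w =
     (if map fst v = map fst w
      then \<Prod>((j, a), (i, b)) \<leftarrow> zip v w. \<tau> i (\<theta> i a \<otimes>\<^bsub>A i\<^esub> b)
      else 0)"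

text \<open>
  Stripping the first letters turns the product over all positions into an entrywise product of two
  kernels, up to the block in which both words are empty.
\<close>

lemma word_kernel_rec:
  "word_kernel A \<theta> \<tau> v w =
     (if v = [] \<and> w = [] then 1 else 0) +
     (if v \<noteq> [] \<and> w \<noteq> []
      then letter_kernel A \<theta> \<tau> (hd v) (hd w) * word_kernel A \<theta> \<tau> (tl v) (tl w) else 0)"
  by (cases v; cases w) (auto simp: word_kernel_def letter_kernel_def)

text \<open>
  The kernel is block diagonal: it is the sum over the finitely many indices that occur of the Gram
  matrices of the forms \<open>\<tau> i (\<theta> i a \<otimes> b)\<close>, each extended by zero to all letters.
\<close>

lemma letter_kernel_positive:
  assumes data: "\<And>i. i \<in> I \<Longrightarrow> reflection_data (A i) (Ap i) (Am i) (\<theta> i)"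
    and \<tau>: "\<And>i. i \<in> I \<Longrightarrow> linear_functional (A i) (\<tau> i)"
    and pos: "\<And>i. i \<in> I \<Longrightarrow> reflection_positive (A i) (Ap i) (Am i) (\<theta> i) (\<tau> i)"
    and J: "finite J" "\<And>x. x \<in> J \<Longrightarrow> f x \<in> (SIGMA i:I. Ap i)"
  shows "positive_kernel J (\<lambda>x y. letter_kernel A \<theta> \<tau> (f x) (f y))"
proof -
  let ?k = "\<lambda>i x y. \<tau> i (\<theta> i (snd (f x)) \<otimes>\<^bsub>A i\<^esub> snd (f y))"
  have "positive_kernel J (\<lambda>x y. if fst (f x) = i \<and> fst (f y) = i then ?k i x y else 0)"
    if "i \<in> fst ` f ` J" for i
  proof (rule positive_kernel_extend_by_zero[OF J(1)])
    have i: "i \<in> I" using that J(2) by fastforce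
    note D = data[OF i, unfolded reflection_data_def complex_subalgebra_def]
    interpret complex_algebra "A i" using D by blast
    show "positive_kernel {x \<in> J. fst (f x) = i} (?k i)"
    proof (rule positive_kernel_of_form[where s = "\<lambda>x y. \<tau> i (\<theta> i x \<otimes>\<^bsub>A i\<^esub> y)" and H = "Ap i"])
      show "sesquilinear_form (A i) (\<lambda>x y. \<tau> i (\<theta> i x \<otimes>\<^bsub>A i\<^esub> y))"
        using D \<tau>[OF i] by (intro reflection_form_sesquilinear) auto
      show "submodule (Ap i) complex_ring (A i)" using D by blast
      show "Ap i \<subseteq> carrier (A i)" using D subringE(1) by blast
      show "\<tau> i (\<theta> i x \<otimes>\<^bsub>A i\<^esub> x) \<in> \<real>\<^sub>\<ge>\<^sub>0" if "x \<in> Ap i" for x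
        using pos[OF i] that by (simp add: reflection_positive_def)
      show "finite {x \<in> J. fst (f x) = i}" using J(1) by simp
      show "snd (f x) \<in> Ap i" if "x \<in> {x \<in> J. fst (f x) = i}" for x
        using that J(2)[of x] by auto
    qed
  qed
  from positive_kernel_sum[OF this]
  have "positive_kernel J (\<lambda>x y. \<Sum>i\<in>fst ` f ` J.
      if fst (f x) = i \<and> fst (f y) = i then ?k i x y else 0)" .
  moreover have "(\<Sum>i\<in>fst ` f ` J. if fst (f x) = i \<and> fst (f y) = i then ?k i x y else 0)
      = letter_kernel A \<theta> \<tau> (f x) (f y)" if "x \<in> J" "y \<in> J" for x y
  proof -
    have "(\<Sum>i\<in>fst ` f ` J. if fst (f x) = i \<and> fst (f y) = i then ?k i x y else 0)
      = (\<Sum>i\<in>fst ` f ` J. if i = fst (f x) then letter_kernel A \<theta> \<tau> (f x) (f y) else 0)"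
      by (intro sum.cong) (auto simp: letter_kernel_def split_beta)
    then show ?thesis using J(1) that by simp
  qed
  ultimately show ?thesis
    by (rule positive_kernel_cong[THEN iffD1, rotated])
qed

text \<open>
  By induction on a bound for the length of the words: apply the Schur product theorem to the kernel of
  the first letters and the kernel of the tails.  Distinct words may have the same tail, so that the
  induction needs families of words.
\<close>

theorem word_kernel_positive:
  assumes data: "\<And>i. i \<in> I \<Longrightarrow> reflection_data (A i) (Ap i) (Am i) (\<theta> i)"
    and \<tau>: "\<And>i. i \<in> I \<Longrightarrow> linear_functional (A i) (\<tau> i)"
    and pos: "\<And>i. i \<in> I \<Longrightarrow> reflection_positive (A i) (Ap i) (Am i) (\<theta> i) (\<tau> i)"
    and "finite J" "\<And>x. x \<in> J \<Longrightarrow> set (f x) \<subseteq> (SIGMA i:I. Ap i)"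
  shows "positive_kernel J (\<lambda>x y. word_kernel A \<theta> \<tau> (f x) (f y))"
proof -
  have "positive_kernel J (\<lambda>x y. word_kernel A \<theta> \<tau> (f x) (f y))"
    if "finite J" "\<And>x. x \<in> J \<Longrightarrow> set (f x) \<subseteq> (SIGMA i:I. Ap i)"
      "\<And>x. x \<in> J \<Longrightarrow> length (f x) \<le> n" for n and J :: "'c set" and f
    using that
  proof (induction n arbitrary: J f)
    case 0
    then have "word_kernel A \<theta> \<tau> (f x) (f y) = 1" if "x \<in> J" "y \<in> J" for x y
      using that by (simp add: word_kernel_def)
    then show ?case
      by (intro positive_kernel_cong[THEN iffD1, OF _ positive_kernel_one]) simp
  next
    case (Suc n)
    let ?J = "{x \<in> J. f x \<noteq> []}"
    have hd: "hd (f x) \<in> (SIGMA i:I. Ap i)" and tl: "set (tl (f x)) \<subseteq> (SIGMA i:I. Ap i)"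
      if "x \<in> ?J" for x
      using that Suc.prems(2)[of x] by (auto dest: hd_in_set list.set_sel(2))
    have len: "length (tl (f x)) \<le> n" if "x \<in> ?J" for x
      using that Suc.prems(3)[of x] by auto
    have "positive_kernel ?J (\<lambda>x y. letter_kernel A \<theta> \<tau> (hd (f x)) (hd (f y)) *
        word_kernel A \<theta> \<tau> (tl (f x)) (tl (f y)))"
      using Suc.prems(1) hd tl len
      by (intro positive_kernel_mult letter_kernel_positive[OF data \<tau> pos] Suc.IH) simp_all
    from positive_kernel_add[OF
        positive_kernel_extend_by_zero[OF Suc.prems(1) positive_kernel_one, of "\<lambda>x. f x = []"]
        positive_kernel_extend_by_zero[OF Suc.prems(1) this]]
    show ?case by (subst word_kernel_rec)
  qed
  from this[of J f "Max ((length \<circ> f) ` J)"] assms(4,5) show ?thesis by simp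
qed

theorem theorem2p3:
  fixes I :: "'i set"
    and A :: "'i \<Rightarrow> 'a calg"
    and Ap Am :: "'i \<Rightarrow> 'a set"
    and \<theta> :: "'i \<Rightarrow> 'a \<Rightarrow> 'a"
    and \<tau> :: "'i \<Rightarrow> 'a \<Rightarrow> complex"
    and B :: "('i, 'a) bifree_elem calg"
    and Bp Bm :: "('i, 'a) bifree_elem set"
    and \<Theta> :: "('i, 'a) bifree_elem \<Rightarrow> ('i, 'a) bifree_elem"
    and T :: "('i, 'a) bifree_elem \<Rightarrow> complex"
  assumes "\<And>i. i \<in> I \<Longrightarrow> reflection_data (A i) (Ap i) (Am i) (\<theta> i)"
    and "\<And>i. i \<in> I \<Longrightarrow> linear_functional (A i) (\<tau> i)"
    and "\<And>i. i \<in> I \<Longrightarrow> \<tau> i \<one>\<^bsub>A i\<^esub> = 1"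
    and "\<And>i. i \<in> I \<Longrightarrow> reflection_positive (A i) (Ap i) (Am i) (\<theta> i) (\<tau> i)"
    and "is_bifree_product I A Ap Am \<theta> \<tau> B Bp Bm \<Theta> T"
  shows "reflection_positive B Bp Bm \<Theta> T"
proof -
  note data = assms(1)[unfolded reflection_data_def]
  have sub: "Ap i \<subseteq> carrier (A i)" if "i \<in> I" for i
    using data[OF that] subringE(1) by (auto simp: complex_subalgebra_def)
  interpret P: algebra_family I "restr A Ap"
    by (rule algebra_family.intro) (use data in \<open>blast intro: complex_algebra_restrict\<close>)
  interpret M: algebra_family I "restr A Am"
    by (rule algebra_family.intro) (use data in \<open>blast intro: complex_algebra_restrict\<close>)
  let ?F = "free_product I (restr A Ap)"
  let ?E = "bifree_embed_plus I A Ap Am"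
  have B: "B = bifree_algebra I A Ap Am" and Bp: "Bp = ?E ` carrier ?F"
    and \<Theta>: "antilinear_hom B B \<Theta>" and T: "linear_functional B T"
    and T_words: "\<And>v w. centred_word I Ap \<tau> v \<Longrightarrow> centred_word I Ap \<tau> w \<Longrightarrow>
        T (list_product B (map (\<lambda>(j, a). \<Theta> (factor_plus I A Ap Am j a)) v @
              map (\<lambda>(i, b). factor_plus I A Ap Am i b) w)) = word_kernel A \<theta> \<tau> v w"
    using assms(5)
    by (auto simp: is_bifree_product_def bifree_plus_def bifree_reflection_def
        bifree_functional_def word_kernel_def)
  interpret F: complex_algebra ?F by (rule P.free_product_algebra)
  interpret B: complex_algebra B
    unfolding B bifree_algebra_def
    by (intro tensor_algebra_algebra P.free_product_algebra M.free_product_algebra)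
  have E: "?E \<in> algebra_hom ?F B"
    using pure_tensor_right_algebra_hom[OF M.free_product_algebra P.free_product_algebra]
    unfolding B bifree_algebra_def bifree_embed_plus_def[abs_def] .
  have \<Theta>_hom: "\<Theta> \<in> ring_hom B B" using \<Theta> by (simp add: antilinear_hom_def)
  define s where "s = (\<lambda>x y. T (\<Theta> (?E x) \<otimes>\<^bsub>B\<^esub> ?E y))"
  have s: "sesquilinear_form ?F s"
    unfolding s_def
    by (rule sesquilinear_form_pullback[OF reflection_form_sesquilinear[OF B.complex_algebra_axioms \<Theta> T] E])
  have s_words: "s (P.word_product v) (P.word_product w) = word_kernel A \<theta> \<tau> v w"
    if "centred_word I Ap \<tau> v" "centred_word I Ap \<tau> w" for v w
  proof -
    have letters: "set w \<subseteq> (SIGMA i:I. carrier (restr A Ap i))" if "centred_word I Ap \<tau> w" for w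
      using that by (auto simp: centred_word_def)
    have E_word: "?E (P.word_product w) =
        list_product B (map (\<lambda>(i, b). factor_plus I A Ap Am i b) w)"
      and factors: "set (map (\<lambda>(i, b). factor_plus I A Ap Am i b) w) \<subseteq> carrier B"
      if "centred_word I Ap \<tau> w" for w
    proof -
      have eq: "map (\<lambda>(i, b). factor_plus I A Ap Am i b) w
          = map ?E (map (\<lambda>(i, b). free_incl I (restr A Ap) i b) w)"
        by (auto simp: factor_plus_def)
      show "?E (P.word_product w) = list_product B (map (\<lambda>(i, b). factor_plus I A Ap Am i b) w)"
        unfolding eq P.word_product_def using E
        by (intro ring_hom_list_product F.ring_axioms P.word_factors_closed letters that)
          (simp add: algebra_hom_def)
      show "set (map (\<lambda>(i, b). factor_plus I A Ap Am i b) w) \<subseteq> carrier B"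
        unfolding eq using P.word_factors_closed[OF letters[OF that]] algebra_homD(1)[OF E]
        by (auto simp del: map_map)
    qed
    let ?v = "map (\<lambda>(j, a). factor_plus I A Ap Am j a) v"
    have "\<Theta> (?E (P.word_product v)) = list_product B (map \<Theta> ?v)"
      unfolding E_word[OF that(1)]
      by (rule ring_hom_list_product[OF \<Theta>_hom B.ring_axioms factors[OF that(1)]])
    moreover have "set (map \<Theta> ?v) \<subseteq> carrier B"
      using factors[OF that(1)] ring_hom_closed[OF \<Theta>_hom] by (auto simp del: map_map)
    ultimately have "\<Theta> (?E (P.word_product v)) \<otimes>\<^bsub>B\<^esub> ?E (P.word_product w) =
        list_product B (map \<Theta> ?v @ map (\<lambda>(i, b). factor_plus I A Ap Am i b) w)"
      using E_word[OF that(2)] factors[OF that(2)] by (simp only: B.list_product_append)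
    moreover have "map \<Theta> ?v = map (\<lambda>(j, a). \<Theta> (factor_plus I A Ap Am j a)) v" by auto
    ultimately show ?thesis using T_words[OF that] by (simp only: s_def)
  qed
  have "s x x \<in> \<real>\<^sub>\<ge>\<^sub>0" if "x \<in> carrier ?F" for x
  proof -
    have "linear_functional (restr A Ap i) (\<tau> i)" "\<tau> i \<one>\<^bsub>restr A Ap i\<^esub> = 1" if "i \<in> I" for i
      using assms(2,3)[OF that] sub[OF that] by (auto simp: linear_functional_def subset_iff)
    from P.centred_words_span[OF this]
    have "carrier ?F \<subseteq> linear_combinations ?F P.word_product {w. centred_word I Ap \<tau> w}"
      by simp
    from subsetD[OF this that] obtain c V where V: "finite V" "V \<subseteq> {w. centred_word I Ap \<tau> w}"
      and x: "x = (\<Oplus>\<^bsub>?F\<^esub>w\<in>V. c w \<odot>\<^bsub>?F\<^esub> P.word_product w)"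
      by (rule linear_combinationsE)
    have letters: "set w \<subseteq> (SIGMA i:I. Ap i)" if "w \<in> V" for w
      using that V(2) by (auto simp: centred_word_def)
    then have "P.word_product w \<in> carrier ?F" if "w \<in> V" for w
      using that by (intro P.word_product_closed) auto
    from F.sesquilinear_form_finsum[OF s V(1) this]
    have "s x x = (\<Sum>v\<in>V. \<Sum>w\<in>V. cnj (c v) * c w * s (P.word_product v) (P.word_product w))"
      unfolding x .
    also have "\<dots> = (\<Sum>v\<in>V. \<Sum>w\<in>V. cnj (c v) * c w * word_kernel A \<theta> \<tau> v w)"
      using s_words V(2) by (intro sum.cong refl) (auto simp: subset_iff)
    also have "\<dots> \<in> \<real>\<^sub>\<ge>\<^sub>0"
      by (rule positive_kernelD[OF word_kernel_positive[OF assms(1,2,4) V(1) letters]])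
    finally show ?thesis .
  qed
  then show ?thesis
    by (auto simp: reflection_positive_def Bp s_def)
qed

end
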